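(* Let $K$ be a field and let $a,d\in\mathbb{N}^2$ be linearly independent over $\mathbb{Q}$ such that $\{a,a+d,a+2d,a+3d\}$ is a minimal generating set of $S_{a,d,3}=\langle a,a+d,a+2d,a+3d\rangle$. Let $R=K[x_1,x_2,x_3,x_4]$. Then the complex $$0\to R^2\xrightarrow{\delta_2}R^3\xrightarrow{\delta_1}R\to R/I_{S_{a,d,3}}\to 0$$ is a minimal graded free resolution of $K[S_{a,d,3}]$, where $$\delta_1=\begin{pmatrix}x_2^2-x_1x_3 & x_2x_3-x_1x_4 & x_3^2-x_2x_4\end{pmatrix},\qquad \delta_2=\begin{pmatrix}-x_3 & x_4\\ x_2 & -x_3\\ -x_1 & x_2\end{pmatrix}.$$
   Context: $\mathbb{N}$ denotes the set of non-negative integers. $\langle a_1,\ldots,a_n\rangle=\{\sum_i\lambda_i a_i\mid \lambda_i\in\mathbb{N}\}$ is the affine semigroup generated by $a_1,\ldots,a_n\in\mathbb{N}^r$. $K[S]=\bigoplus_{s\in S}K\mathbf{t}^s\subseteq K[t_1,\ldots,t_r]$ is the semigroup ring of $S$. The defining ideal $I_{S_{a,d,3}}$ is the kernel of the $K$-algebra homomorphism $R\to K[S_{a,d,3}]$, $x_i\mapsto\mathbf{t}^{a+(i-1)d}$, so $K[S_{a,d,3}]\cong R/I_{S_{a,d,3}}$. $R$ is graded by $\deg x_i=a+(i-1)d$, and the free modules carry the degree shifts making the maps degree-preserving. Matrices act on column vectors. *)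

theory Defs
  imports "HOL-Analysis.Analysis" "HOL-Library.Poly_Mapping" "HOL-Algebra.Algebra"
    "HOL-Algebra.Algebraic_Closure_Type"
begin

section \<open>Affine semigroups\<close>

text \<open>Only used for finite \<open>A\<close>; the coefficients range over the non-negative integers.\<close>

definition affine_semigroup :: "(nat ^ 'r) set \<Rightarrow> (nat ^ 'r) set" where
  "affine_semigroup A = {(\<Sum>v\<in>A. c v *s v) | c :: nat ^ 'r \<Rightarrow> nat. True}"

definition minimal_generating_set :: "(nat ^ 'r) set \<Rightarrow> (nat ^ 'r) set \<Rightarrow> bool" where
  "minimal_generating_set A S \<longleftrightarrow>
     affine_semigroup A = S \<and> (\<forall>B. B \<subset> A \<longrightarrow> affine_semigroup B \<noteq> S)"

definition rat_vec :: "nat ^ 'r \<Rightarrow> rat ^ 'r" where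
  "rat_vec v = (\<chi> i. of_nat (v $ i))"

text \<open>\<^const>\<open>vec.independent\<close> speaks about sets, so the two vectors have to be
  distinguished separately.\<close>

definition lin_independent_over_rat :: "nat ^ 'r \<Rightarrow> nat ^ 'r \<Rightarrow> bool" where
  "lin_independent_over_rat u v \<longleftrightarrow> u \<noteq> v \<and> vec.independent {rat_vec u, rat_vec v}"

section \<open>Polynomial rings and semigroup rings\<close>

text \<open>Polynomials in variables indexed by \<open>'n\<close>: finitely supported functions from exponent
  vectors to coefficients, multiplied by convolution.\<close>

type_synonym ('k, 'n) mpoly = "(nat ^ 'n) \<Rightarrow>\<^sub>0 'k"

definition Var :: "'n :: finite \<Rightarrow> ('k :: field, 'n) mpoly" where
  "Var i = Poly_Mapping.single (axis i 1) 1"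

definition tpow :: "nat ^ 'r \<Rightarrow> ('k :: field, 'r) mpoly" where
  "tpow s = Poly_Mapping.single s 1"

abbreviation mpoly_ring :: "('k :: field, 'n :: finite) mpoly ring" where
  "mpoly_ring \<equiv> ring_of_type_algebra"

definition semigroup_ring :: "(nat ^ 'r) set \<Rightarrow> ('k :: field, 'r) mpoly ring" where
  "semigroup_ring S =
     \<lparr>carrier = {p. Poly_Mapping.keys p \<subseteq> S}, monoid.mult = (*), one = 1, ring.zero = 0, add = (+)\<rparr>"

text \<open>The homomorphism of algebras over the coefficient field sending the variable \<open>i\<close> to
  \<open>y i\<close>.\<close>

definition poly_subst ::
    "('n :: finite \<Rightarrow> ('k, 'r :: finite) mpoly) \<Rightarrow> ('k :: field, 'n) mpoly \<Rightarrow> ('k, 'r) mpoly" where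
  "poly_subst y p = (\<Sum>m\<in>Poly_Mapping.keys p.
     Poly_Mapping.single 0 (Poly_Mapping.lookup p m) * (\<Prod>i\<in>UNIV. y i ^ (m $ i)))"

text \<open>In the following, \<open>w $ i\<close> is the generator, and hence the degree, attached to the
  variable \<open>i\<close>.\<close>

definition semigroup_hom :: "(nat ^ 'r) ^ 'n \<Rightarrow> ('k :: field, 'n) mpoly \<Rightarrow> ('k, 'r) mpoly" where
  "semigroup_hom w = poly_subst (\<lambda>i. tpow (w $ i))"

definition gen_semigroup :: "(nat ^ 'r) ^ 'n \<Rightarrow> (nat ^ 'r) set" where
  "gen_semigroup w = affine_semigroup (range (\<lambda>i. w $ i))"

definition defining_ideal :: "(nat ^ 'r) ^ 'n \<Rightarrow> ('k :: field, 'n) mpoly set" where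
  "defining_ideal w = a_kernel mpoly_ring (semigroup_ring (gen_semigroup w)) (semigroup_hom w)"

section \<open>Graded modules\<close>

text \<open>\<open>A\<close> is the family of homogeneous components of the ring, \<open>B\<close> that of the module. The
  last conjunct says that the module is the direct sum of its components.\<close>

definition graded_module ::
    "('a, 'm) ring_scheme \<Rightarrow> ('g :: comm_monoid_add \<Rightarrow> 'a set) \<Rightarrow>
     ('a, 'b) module \<Rightarrow> ('g \<Rightarrow> 'b set) \<Rightarrow> bool" where
  "graded_module R A M B \<longleftrightarrow>
     Module.module R M \<and>
     (\<forall>g. additive_subgroup (B g) M) \<and>
     (\<forall>g h. \<forall>r\<in>A g. \<forall>x\<in>B h. module.smult M r x \<in> B (g + h)) \<and>
     (\<forall>x\<in>carrier M. \<exists>!c. (\<forall>g. c g \<in> B g) \<and> finite {g. c g \<noteq> ring.zero M} \<and>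
        x = finsum M c {g. c g \<noteq> ring.zero M})"

text \<open>Degree-preserving homomorphisms of modules.\<close>

definition graded_hom ::
    "('a, 'm) ring_scheme \<Rightarrow> ('a, 'b) module \<Rightarrow> ('g \<Rightarrow> 'b set) \<Rightarrow>
     ('a, 'c) module \<Rightarrow> ('g \<Rightarrow> 'c set) \<Rightarrow> ('b \<Rightarrow> 'c) set" where
  "graded_hom R M B N C =
     {f. f \<in> carrier M \<rightarrow> carrier N \<and>
         (\<forall>x\<in>carrier M. \<forall>y\<in>carrier M. f (add M x y) = add N (f x) (f y)) \<and>
         (\<forall>r\<in>carrier R. \<forall>x\<in>carrier M. f (module.smult M r x) = module.smult N r (f x)) \<and>
         (\<forall>g. f ` B g \<subseteq> C g)}"

definition graded_isomorphic ::
    "('a, 'm) ring_scheme \<Rightarrow> ('g :: comm_monoid_add \<Rightarrow> 'a set) \<Rightarrow>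
     ('a, 'b) module \<Rightarrow> ('g \<Rightarrow> 'b set) \<Rightarrow> ('a, 'c) module \<Rightarrow> ('g \<Rightarrow> 'c set) \<Rightarrow> bool" where
  "graded_isomorphic R A M B N C \<longleftrightarrow>
     graded_module R A M B \<and> graded_module R A N C \<and>
     (\<exists>f \<in> graded_hom R M B N C. bij_betw f (carrier M) (carrier N))"

definition monom_degree :: "(nat ^ 'r) ^ 'n \<Rightarrow> nat ^ 'n \<Rightarrow> nat ^ 'r" where
  "monom_degree w m = (\<Sum>i\<in>UNIV. m $ i *s w $ i)"

definition poly_comp :: "(nat ^ 'r) ^ 'n \<Rightarrow> nat ^ 'r \<Rightarrow> ('k :: field, 'n) mpoly set" where
  "poly_comp w g = {p. \<forall>m\<in>Poly_Mapping.keys p. monom_degree w m = g}"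

definition free_module :: "(('k :: field, 'n :: finite) mpoly, ('k, 'n) mpoly ^ 'm) module" where
  "free_module =
     \<lparr>carrier = UNIV, monoid.mult = undefined, one = undefined, ring.zero = 0,
      add = (+), module.smult = (*s)\<rparr>"

text \<open>The components of the direct sum of the shifted modules \<open>R(- s i)\<close>: the \<open>i\<close>-th basis
  vector has degree \<open>s i\<close>, so the \<open>i\<close>-th entry of a vector of degree \<open>g\<close> lies in degree
  \<open>g - s i\<close>. Since subtraction on exponent vectors truncates, this is written additively; if
  \<open>g - s i\<close> is not a vector of non-negative integers, the entry is forced to be 0.\<close>

definition free_comp ::
    "(nat ^ 'r) ^ 'n \<Rightarrow> ('m \<Rightarrow> nat ^ 'r) \<Rightarrow> nat ^ 'r \<Rightarrow> (('k :: field, 'n) mpoly ^ 'm) set" where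
  "free_comp w s g =
     {v. \<forall>i. \<forall>m\<in>Poly_Mapping.keys (v $ i). monom_degree w m + s i = g}"

definition quotient_module ::
    "('k :: field, 'n :: finite) mpoly set \<Rightarrow> (('k, 'n) mpoly, ('k, 'n) mpoly set) module" where
  "quotient_module I = (let Q = mpoly_ring Quot I in
     \<lparr>carrier = carrier Q, monoid.mult = monoid.mult Q, one = one Q,
      ring.zero = ring.zero Q, add = add Q, module.smult = (\<lambda>r C. monoid.mult Q (a_r_coset mpoly_ring I r) C)\<rparr>)"

definition quotient_comp ::
    "(nat ^ 'r) ^ 'n \<Rightarrow> ('k :: field, 'n) mpoly set \<Rightarrow> nat ^ 'r \<Rightarrow> ('k, 'n) mpoly set set" where
  "quotient_comp w I g = (\<lambda>p. a_r_coset mpoly_ring I p) ` poly_comp w g"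

text \<open>The semigroup ring as a module over the polynomial ring, via \<^const>\<open>semigroup_hom\<close>.\<close>

definition semigroup_module ::
    "(nat ^ 'r) ^ 'n \<Rightarrow> (('k :: field, 'n) mpoly, ('k, 'r) mpoly) module" where
  "semigroup_module w = (let Q = semigroup_ring (gen_semigroup w) in
     \<lparr>carrier = carrier Q, monoid.mult = monoid.mult Q, one = one Q,
      ring.zero = ring.zero Q, add = add Q, module.smult = (\<lambda>r q. monoid.mult Q (semigroup_hom w r) q)\<rparr>)"

definition semigroup_comp ::
    "(nat ^ 'r) ^ 'n \<Rightarrow> nat ^ 'r \<Rightarrow> ('k :: field, 'r) mpoly set" where
  "semigroup_comp w g =
     {p \<in> carrier (semigroup_ring (gen_semigroup w)). Poly_Mapping.keys p \<subseteq> {g}}"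

section \<open>Minimal graded free resolutions of length two\<close>

definition irrelevant_ideal :: "('k :: field, 'n :: finite) mpoly set" where
  "irrelevant_ideal = genideal mpoly_ring (range Var)"

text \<open>The complex is
  \<open>0 \<rightarrow> F\<^sub>2 \<rightarrow> F\<^sub>1 \<rightarrow> F\<^sub>0 \<rightarrow> M \<rightarrow> 0\<close>, where
  \<open>F\<^sub>j\<close> is free with basis degrees \<open>s\<^sub>j\<close>, the matrices \<open>\<delta>\<^sub>2\<close> and \<open>\<delta>\<^sub>1\<close> act on column vectors and
  \<open>\<epsilon>\<close> is the augmentation. The four conjuncts after the homomorphisms are exactness at
  \<open>F\<^sub>2\<close>, \<open>F\<^sub>1\<close>, \<open>F\<^sub>0\<close> and \<open>M\<close>. Minimality means that the image of \<open>F\<^sub>j\<close> lies in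
  \<open>\<mm> F\<^bsub>j-1\<^esub>\<close>, i.e. consists of vectors with entries in the ideal \<open>\<mm>\<close> generated by the variables.\<close>

definition minimal_graded_free_resolution ::
    "(nat ^ 'r) ^ 'n \<Rightarrow> ('m2 \<Rightarrow> nat ^ 'r) \<Rightarrow> ('m1 \<Rightarrow> nat ^ 'r) \<Rightarrow> ('m0 \<Rightarrow> nat ^ 'r) \<Rightarrow>
     ('k :: field, 'n) mpoly ^ 'm2 ^ 'm1 \<Rightarrow> ('k, 'n) mpoly ^ 'm1 ^ 'm0 \<Rightarrow>
     (('k, 'n) mpoly ^ 'm0 \<Rightarrow> 'b) \<Rightarrow> (('k, 'n) mpoly, 'b) module \<Rightarrow> (nat ^ 'r \<Rightarrow> 'b set) \<Rightarrow>
     bool" where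
  "minimal_graded_free_resolution w s2 s1 s0 \<delta>2 \<delta>1 \<epsilon> M B \<longleftrightarrow>
     graded_module mpoly_ring (poly_comp w) M B \<and>
     (*v) \<delta>2 \<in> graded_hom mpoly_ring free_module (free_comp w s2) free_module (free_comp w s1) \<and>
     (*v) \<delta>1 \<in> graded_hom mpoly_ring free_module (free_comp w s1) free_module (free_comp w s0) \<and>
     \<epsilon> \<in> graded_hom mpoly_ring free_module (free_comp w s0) M B \<and>
     inj ((*v) \<delta>2) \<and>
     range ((*v) \<delta>2) = {v. \<delta>1 *v v = 0} \<and>
     range ((*v) \<delta>1) = {v. \<epsilon> v = ring.zero M} \<and>
     range \<epsilon> = carrier M \<and>
     range ((*v) \<delta>2) \<subseteq> {v. \<forall>i. v $ i \<in> irrelevant_ideal} \<and>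
     range ((*v) \<delta>1) \<subseteq> {v. \<forall>i. v $ i \<in> irrelevant_ideal}"

section \<open>The semigroup generated by an arithmetic progression of four vectors\<close>

definition arith_gens :: "nat ^ 'r \<Rightarrow> nat ^ 'r \<Rightarrow> (nat ^ 'r) ^ 4" where
  "arith_gens a d = vector [a, a + d, a + 2 *s d, a + 3 *s d]"

definition delta1 :: "('k :: field, 4) mpoly ^ 3 ^ 1" where
  "delta1 = vector [vector
     [(Var 2)\<^sup>2 - Var 1 * Var 3, Var 2 * Var 3 - Var 1 * Var 4, (Var 3)\<^sup>2 - Var 2 * Var 4]]"

definition delta2 :: "('k :: field, 4) mpoly ^ 2 ^ 3" where
  "delta2 = vector
     [vector [- Var 3,   Var 4],
      vector [  Var 2, - Var 3],
      vector [- Var 1,   Var 2]]"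

end

theory Submission
  imports Defs
begin

text \<open>
  Write $f_1 = x_2^2 - x_1x_3$, $f_2 = x_2x_3 - x_1x_4$, $f_3 = x_3^2 - x_2x_4$ for the entries of
  $\delta_1$; they are, up to sign, the maximal minors of $\delta_2$. Exactness rests on two
  reductions by explicit rewriting, one for polynomials and one for vectors of polynomials, and on
  comparing exponents.

  \<^emph>\<open>The ideal.\<close> Read as rewriting rules $x_2^2 \to x_1x_3$, $x_2x_3 \to x_1x_4$,
  $x_3^2 \to x_2x_4$, the generators bring every polynomial to a combination of the monomials
  $x_1^i x_4^j$, $x_1^i x_2 x_4^j$, $x_1^i x_3 x_4^j$ (\<open>reduce_mod_minors\<close>). The degree of a monomial
  is $n a + s d$ with $n = m_1 + m_2 + m_3 + m_4$ and $s = m_2 + 2m_3 + 3m_4$. Independence of $a$ and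
  $d$ recovers $n$ and $s$ from it, and for the normal monomials the residue of $s$ modulo 3 recovers
  $m_2$ and $m_3$, hence all exponents. So distinct normal monomials have distinct images, a normal
  form in the kernel is 0, and the defining ideal is $(f_1, f_2, f_3)$
  (\<open>defining_ideal_arith_gens\<close>).

  \<^emph>\<open>The syzygies.\<close> Modulo the columns of $\delta_2$, the first two entries of a vector can be
  made free of $x_3$ (\<open>reduce_mod_delta2\<close>). A syzygy of this shape vanishes
  (\<open>x3_free_syzygy_trivial\<close>): $f_3$ is monic of degree 2 in $x_3$ whereas $f_1$ and $f_2$ have degree
  1, which kills the third entry; the rest is a $2 \times 2$ system over $K[x_1,x_2,x_4]$ with
  determinant $\pm(x_2^3 - x_1^2x_4) \ne 0$. Injectivity of $\delta_2$ is the same kind of argument.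
  A difference of two distinct monomials is a non-zero-divisor because multiplication by a monomial
  translates exponents (\<open>tpow_mult_eq_tpow_mult_imp_zero\<close>).

  \<^emph>\<open>The gradings.\<close> The semigroup ring is graded by inspection of supports; the grading of the
  quotient is carried over along the isomorphism of the first isomorphism theorem
  (\<open>graded_module_transport\<close>, \<open>quotient_graded_isomorphic\<close>). The shifts are the degrees of the
  $f_i$ and of the products of the $f_i$ with the entries of $\delta_2$.\<close>

(* In this file the dollar sign is the component of a vector, not the coefficient of a power series. *)
no_notation fps_nth (infixl \<open>$\<close> 75)

section \<open>Supports of polynomials and multiplication by monomials\<close>

lemma poly_mapping_sum_single:
  "p = (\<Sum>m\<in>Poly_Mapping.keys p. Poly_Mapping.single m (Poly_Mapping.lookup p m))"
  by (rule poly_mapping_eqI) (auto simp: lookup_sum lookup_single when_def in_keys_iff)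

text \<open>Bilinear identities need only be checked on terms, without tracking which exponents occur.\<close>

lemma poly_mapping_add_induct [case_names single add]:
  fixes p :: "'a \<Rightarrow>\<^sub>0 'b :: comm_monoid_add"
  assumes single: "\<And>m c. P (Poly_Mapping.single m c)"
    and add: "\<And>p q. P p \<Longrightarrow> P q \<Longrightarrow> P (p + q)"
  shows "P p"
proof -
  have "P (\<Sum>m\<in>M. Poly_Mapping.single m (Poly_Mapping.lookup p m))" if "finite M" for M
    using that
  proof (induction M rule: finite_induct)
    case empty
    show ?case using single[of undefined 0] by simp
  qed (auto intro: assms)
  then show ?thesis
    using poly_mapping_sum_single[of p] by (metis finite_keys)
qed

lemma keys_diff_subset:
  fixes p q :: "'a \<Rightarrow>\<^sub>0 'b :: ab_group_add"
  assumes "Poly_Mapping.keys p \<subseteq> D" "Poly_Mapping.keys q \<subseteq> D"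
  shows "Poly_Mapping.keys (p - q) \<subseteq> D"
proof
  fix k assume "k \<in> Poly_Mapping.keys (p - q)"
  then have "k \<in> Poly_Mapping.keys p \<or> k \<in> Poly_Mapping.keys q"
    by (simp add: in_keys_iff lookup_minus) (metis diff_self)
  with assms show "k \<in> D" by blast
qed

lemma keys_add_subset:
  fixes p q :: "'a \<Rightarrow>\<^sub>0 'b :: monoid_add"
  assumes "Poly_Mapping.keys p \<subseteq> D" "Poly_Mapping.keys q \<subseteq> D"
  shows "Poly_Mapping.keys (p + q) \<subseteq> D"
  using assms Poly_Mapping.keys_add[of p q] by blast

lemma tpow_0: "tpow 0 = (1 :: ('k :: field, 'n :: finite) mpoly)"
  by (simp add: tpow_def)

lemma tpow_mult_tpow: "tpow a * tpow b = (tpow (a + b) :: ('k :: field, 'n :: finite) mpoly)"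
  by (simp add: tpow_def mult_single)

lemma tpow_power: "tpow s ^ n = (tpow (n *s s) :: ('k :: field, 'n :: finite) mpoly)"
proof (induction n)
  case 0
  have "0 *s s = 0" by (simp add: vec_eq_iff)
  then show ?case by (simp add: tpow_0)
next
  case (Suc n)
  have "s + n *s s = Suc n *s s" by (simp add: vec_eq_iff)
  with Suc show ?case by (simp add: tpow_mult_tpow)
qed

lemma prod_tpow: "(\<Prod>i\<in>A. tpow (s i)) = (tpow (\<Sum>i\<in>A. s i) :: ('k :: field, 'n :: finite) mpoly)"
  by (induction A rule: infinite_finite_induct) (simp_all add: tpow_0 tpow_mult_tpow)

lemma lookup_tpow_mult:
  "Poly_Mapping.lookup (tpow a * p) (a + k) = Poly_Mapping.lookup (p :: ('k :: field, 'n :: finite) mpoly) k"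
  by (induction p rule: poly_mapping_add_induct)
     (auto simp: tpow_def mult_single lookup_single when_def distrib_left lookup_add)

lemma keys_tpow_mult:
  "Poly_Mapping.keys (tpow a * p) = (+) a ` Poly_Mapping.keys (p :: ('k :: field, 'n :: finite) mpoly)"
proof
  show "Poly_Mapping.keys (tpow a * p) \<subseteq> (+) a ` Poly_Mapping.keys p"
    using keys_mult[of "tpow a" p] by (auto simp: tpow_def)
  show "(+) a ` Poly_Mapping.keys p \<subseteq> Poly_Mapping.keys (tpow a * p)"
    by (auto simp: in_keys_iff lookup_tpow_mult)
qed

lemma ex_key_max:
  fixes p :: "('k :: field, 'n :: finite) mpoly"
  assumes "p \<noteq> 0"
  obtains k where "k \<in> Poly_Mapping.keys p" "\<And>l. l \<in> Poly_Mapping.keys p \<Longrightarrow> l $ i \<le> k $ i"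
proof -
  have "finite ((\<lambda>k. k $ i) ` Poly_Mapping.keys p)" "(\<lambda>k. k $ i) ` Poly_Mapping.keys p \<noteq> {}"
    using assms by auto
  then show ?thesis
    using Max_in Max_ge that by (smt (verit) imageE image_eqI)
qed

text \<open>The monomials $t^a$ and $t^b$ translate the support of $p$ by $a$ and by $b$, so equality of the
  products would give two equal finite sets with different largest $i$-th exponents, unless both are
  empty. This says that $t^a - t^b$ is a non-zero-divisor.\<close>

lemma tpow_mult_eq_tpow_mult_imp_zero:
  fixes p :: "('k :: field, 'n :: finite) mpoly"
  assumes eq: "tpow a * p = tpow b * p" and less: "(a :: nat ^ 'n) $ i < b $ i"
  shows "p = 0"
proof (rule ccontr)
  assume "p \<noteq> 0"
  then obtain k where k: "k \<in> Poly_Mapping.keys p"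
    and max: "\<And>l. l \<in> Poly_Mapping.keys p \<Longrightarrow> l $ i \<le> k $ i"
    using ex_key_max[of p i] by blast
  have "b + k \<in> (+) a ` Poly_Mapping.keys p"
    using k eq keys_tpow_mult[of a p] keys_tpow_mult[of b p] by auto
  then obtain l where l: "l \<in> Poly_Mapping.keys p" "b + k = a + l"
    by auto
  have "b $ i + k $ i = a $ i + l $ i"
    using arg_cong[OF l(2), of "\<lambda>v. v $ i"] by simp
  with less max[OF l(1)] show False by simp
qed

lemma tpow_mult_eq_0_iff: "tpow a * p = 0 \<longleftrightarrow> p = (0 :: ('k :: field, 'n :: finite) mpoly)"
  using keys_tpow_mult[of a p] by (metis image_is_empty keys_eq_empty)

lemma Var_eq_tpow: "Var i = tpow (axis i 1)"
  by (simp add: Var_def tpow_def)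

lemma keys_Var_mult:
  "Poly_Mapping.keys (Var i * p) = (+) (axis i 1) ` Poly_Mapping.keys (p :: ('k :: field, 'n :: finite) mpoly)"
  by (simp add: Var_eq_tpow keys_tpow_mult)

lemma keys_Var: "Poly_Mapping.keys (Var i :: ('k :: field, 'n :: finite) mpoly) = {axis i 1}"
  by (simp add: Var_def)

lemma keys_Var_mult_Var:
  "Poly_Mapping.keys (Var i * Var j :: ('k :: field, 'n :: finite) mpoly) = {axis i 1 + axis j 1}"
  by (simp add: Var_def mult_single)

lemma Var_mult_single:
  "Var i * Poly_Mapping.single n c = Poly_Mapping.single (axis i 1 + n) (c :: 'k :: field)"
  by (simp add: Var_def mult_single)

lemma exponent_split:
  fixes m :: "nat ^ 'n :: finite"
  assumes "m $ i \<noteq> 0"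
  obtains n where "m = axis i 1 + n"
proof
  show "m = axis i 1 + (m - axis i 1)"
    using assms by (auto simp: vec_eq_iff axis_def)
qed

section \<open>The homomorphism onto the semigroup ring\<close>

lemma monom_degree_add: "monom_degree w (m + n) = monom_degree w m + monom_degree w n"
  by (simp add: monom_degree_def vec_eq_iff sum.distrib[symmetric] distrib_right)

lemma monom_degree_0: "monom_degree w 0 = 0"
  by (simp add: monom_degree_def vec_eq_iff)

lemma monom_degree_axis: "monom_degree w (axis i 1) = w $ i"
  for w :: "(nat ^ 'r :: finite) ^ 'n :: finite"
  by (simp add: monom_degree_def axis_def vec_eq_iff if_distrib[of "\<lambda>x. x * _"] cong: if_cong)

text \<open>Summing over any finite set that contains the support makes the homomorphism additive by
  inspection, although the supports of two polynomials and of their sum differ.\<close>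

lemma semigroup_hom_sum_superset:
  fixes w :: "(nat ^ 'r :: finite) ^ 'n :: finite" and p :: "('k :: field, 'n) mpoly"
  assumes "finite M" "Poly_Mapping.keys p \<subseteq> M"
  shows "semigroup_hom w p =
    (\<Sum>m\<in>M. Poly_Mapping.single (monom_degree w m) (Poly_Mapping.lookup p m))"
proof -
  have "semigroup_hom w p = (\<Sum>m\<in>Poly_Mapping.keys p.
      Poly_Mapping.single (monom_degree w m) (Poly_Mapping.lookup p m))"
    unfolding semigroup_hom_def poly_subst_def tpow_power prod_tpow monom_degree_def[symmetric]
    by (simp add: tpow_def mult_single)
  also have "\<dots> = (\<Sum>m\<in>M. Poly_Mapping.single (monom_degree w m) (Poly_Mapping.lookup p m))"
    using assms by (intro sum.mono_neutral_left) (auto simp: in_keys_iff)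
  finally show ?thesis .
qed

lemma semigroup_hom_single:
  fixes w :: "(nat ^ 'r :: finite) ^ 'n :: finite" and c :: "'k :: field"
  shows "semigroup_hom w (Poly_Mapping.single m c) = Poly_Mapping.single (monom_degree w m) c"
  by (subst semigroup_hom_sum_superset[of "{m}"]) auto

lemma semigroup_hom_add:
  fixes w :: "(nat ^ 'r :: finite) ^ 'n :: finite" and p q :: "('k :: field, 'n) mpoly"
  shows "semigroup_hom w (p + q) = semigroup_hom w p + semigroup_hom w q"
proof -
  let ?M = "Poly_Mapping.keys p \<union> Poly_Mapping.keys q"
  have "semigroup_hom w r = (\<Sum>m\<in>?M. Poly_Mapping.single (monom_degree w m) (Poly_Mapping.lookup r m))"
    if "Poly_Mapping.keys r \<subseteq> ?M" for r :: "('k, 'n) mpoly"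
    using that by (intro semigroup_hom_sum_superset) auto
  then show ?thesis
    using Poly_Mapping.keys_add[of p q]
    by (simp add: lookup_add single_add sum.distrib)
qed

lemma semigroup_hom_0: "semigroup_hom w (0 :: ('k :: field, 'n :: finite) mpoly) = 0"
  for w :: "(nat ^ 'r :: finite) ^ 'n"
  by (subst semigroup_hom_sum_superset[of "{}"]) auto

lemma semigroup_hom_sum: "semigroup_hom w (\<Sum>x\<in>A. f x) = (\<Sum>x\<in>A. semigroup_hom w (f x :: ('k :: field, 'n :: finite) mpoly))"
  for w :: "(nat ^ 'r :: finite) ^ 'n"
  by (induction A rule: infinite_finite_induct) (simp_all add: semigroup_hom_0 semigroup_hom_add)

lemma semigroup_hom_1: "semigroup_hom w (1 :: ('k :: field, 'n :: finite) mpoly) = 1"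
  for w :: "(nat ^ 'r :: finite) ^ 'n"
  using semigroup_hom_single[of w 0 1] by (simp add: monom_degree_0)

lemma semigroup_hom_mult:
  fixes w :: "(nat ^ 'r :: finite) ^ 'n :: finite" and p q :: "('k :: field, 'n) mpoly"
  shows "semigroup_hom w (p * q) = semigroup_hom w p * semigroup_hom w q"
proof (induction p rule: poly_mapping_add_induct)
  case (single m c)
  show ?case
    by (induction q rule: poly_mapping_add_induct)
       (simp_all add: mult_single semigroup_hom_single monom_degree_add distrib_left semigroup_hom_add)
qed (simp add: distrib_right semigroup_hom_add)

lemma semigroup_hom_diff:
  fixes w :: "(nat ^ 'r :: finite) ^ 'n :: finite" and p q :: "('k :: field, 'n) mpoly"
  shows "semigroup_hom w (p - q) = semigroup_hom w p - semigroup_hom w q"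
  using semigroup_hom_add[of w "p - q" q] by simp

lemma semigroup_hom_Var: "semigroup_hom w (Var i) = tpow (w $ i)"
  for w :: "(nat ^ 'r :: finite) ^ 'n :: finite"
  unfolding Var_def semigroup_hom_single monom_degree_axis tpow_def ..

text \<open>When the monomials of $p$ have pairwise different degrees, no two terms of the image are
  collected, so the coefficients of $p$ can be read off from the image.\<close>

lemma semigroup_hom_eq_0_imp_eq_0:
  fixes w :: "(nat ^ 'r :: finite) ^ 'n :: finite" and p :: "('k :: field, 'n) mpoly"
  assumes inj: "inj_on (monom_degree w) (Poly_Mapping.keys p)"
    and zero: "semigroup_hom w p = 0"
  shows "p = 0"
proof (rule ccontr)
  assume "p \<noteq> 0"
  then obtain n where n: "n \<in> Poly_Mapping.keys p"
    by (metis all_not_in_conv keys_eq_empty)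
  have "Poly_Mapping.lookup (semigroup_hom w p) (monom_degree w n) =
    (\<Sum>m\<in>Poly_Mapping.keys p. if m = n then Poly_Mapping.lookup p m else 0)"
    using inj n
    by (subst semigroup_hom_sum_superset[OF finite_keys order_refl])
       (auto simp: lookup_sum lookup_single when_def inj_on_eq_iff intro!: sum.cong)
  also have "\<dots> = Poly_Mapping.lookup p n"
    using n by simp
  finally show False
    using n zero by (simp add: in_keys_iff)
qed

text \<open>The semigroup is given by combinations over the \<^emph>\<open>set\<close> of generators, degrees of monomials by
  combinations over the \<^emph>\<open>family\<close>. The two agree even if generators repeat: in one direction
  coefficients of equal generators are added up, in the other one index is chosen per generator.\<close>

lemma gen_semigroup_eq_range:
  fixes w :: "(nat ^ 'r :: finite) ^ 'n :: finite"
  shows "gen_semigroup w = range (monom_degree w)"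
proof
  show "gen_semigroup w \<subseteq> range (monom_degree w)"
  proof
    fix s assume "s \<in> gen_semigroup w"
    then obtain c where s: "s = (\<Sum>v\<in>range (($) w). c v *s v)"
      by (auto simp: gen_semigroup_def affine_semigroup_def)
    \<comment> \<open>One index for each distinct generator.\<close>
    obtain J where J: "inj_on (($) w) J" "range (($) w) = ($) w ` J"
      by (metis subset_image_inj order_refl)
    define m :: "nat ^ 'n" where "m = (\<chi> i. if i \<in> J then c (w $ i) else 0)"
    have "s = (\<Sum>i\<in>J. c (w $ i) *s w $ i)"
      using J by (simp add: s sum.reindex)
    also have "\<dots> = (\<Sum>i\<in>UNIV. m $ i *s w $ i)"
      by (rule sum.mono_neutral_cong_left) (auto simp: m_def vec_eq_iff)
    finally show "s \<in> range (monom_degree w)"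
      by (auto simp: monom_degree_def)
  qed
  show "range (monom_degree w) \<subseteq> gen_semigroup w"
  proof
    fix s assume "s \<in> range (monom_degree w)"
    then obtain m where s: "s = (\<Sum>i\<in>UNIV. m $ i *s w $ i)"
      by (auto simp: monom_degree_def)
    define c where "c v = (\<Sum>i\<in>{i. w $ i = v}. m $ i)" for v
    have "s = (\<Sum>v\<in>range (($) w). \<Sum>i\<in>{i \<in> UNIV. w $ i = v}. m $ i *s w $ i)"
      unfolding s by (rule sum.image_gen) simp
    also have "\<dots> = (\<Sum>v\<in>range (($) w). c v *s v)"
      by (intro sum.cong refl) (simp add: c_def vec_eq_iff sum_distrib_right)
    finally show "s \<in> gen_semigroup w"
      by (auto simp: gen_semigroup_def affine_semigroup_def)
  qed
qed

lemma keys_semigroup_hom: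
  fixes w :: "(nat ^ 'r :: finite) ^ 'n :: finite" and p :: "('k :: field, 'n) mpoly"
  shows "Poly_Mapping.keys (semigroup_hom w p) \<subseteq> gen_semigroup w"
proof (induction p rule: poly_mapping_add_induct)
  case (add p q)
  then show ?case
    using Poly_Mapping.keys_add[of "semigroup_hom w p" "semigroup_hom w q"]
    by (auto simp: semigroup_hom_add)
qed (simp add: semigroup_hom_single gen_semigroup_eq_range)

lemma mpoly_ring_simps [simp]:
  "carrier mpoly_ring = UNIV" "monoid.mult mpoly_ring = (*)" "one mpoly_ring = 1"
  "ring.zero mpoly_ring = 0" "add mpoly_ring = (+)"
  by (simp_all add: ring_of_type_algebra_def)

lemma semigroup_ring_simps [simp]:
  "carrier (semigroup_ring S) = {p. Poly_Mapping.keys p \<subseteq> S}"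
  "monoid.mult (semigroup_ring S) = (*)" "one (semigroup_ring S) = 1"
  "ring.zero (semigroup_ring S) = 0" "add (semigroup_ring S) = (+)"
  by (simp_all add: semigroup_ring_def)

lemma cring_semigroup_ring:
  fixes S :: "(nat ^ 'r :: finite) set"
  assumes zero: "0 \<in> S" and add: "\<And>s t. s \<in> S \<Longrightarrow> t \<in> S \<Longrightarrow> s + t \<in> S"
  shows "cring (semigroup_ring S :: ('k :: field, 'r) mpoly ring)"
proof (rule cringI)
  show "abelian_group (semigroup_ring S :: ('k, 'r) mpoly ring)"
  proof (rule abelian_groupI)
    fix p :: "('k, 'r) mpoly" assume "p \<in> carrier (semigroup_ring S)"
    then show "\<exists>q\<in>carrier (semigroup_ring S). q \<oplus>\<^bsub>semigroup_ring S\<^esub> p = \<zero>\<^bsub>semigroup_ring S\<^esub>"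
      by (intro bexI[of _ "- p"]) (auto simp: in_keys_iff)
  qed (auto dest!: subsetD[OF Poly_Mapping.keys_add] simp: add.assoc add.commute)
  show "comm_monoid (semigroup_ring S :: ('k, 'r) mpoly ring)"
    by (rule comm_monoidI)
       (auto dest!: subsetD[OF keys_mult] intro!: add simp: zero mult.assoc mult.commute)
qed (simp add: distrib_right)

lemma ring_hom_semigroup_hom:
  fixes w :: "(nat ^ 'r :: finite) ^ 'n :: finite"
  shows "ring_hom_cring mpoly_ring (semigroup_ring (gen_semigroup w))
    (semigroup_hom w :: ('k :: field, 'n) mpoly \<Rightarrow> ('k, 'r) mpoly)"
proof (intro ring_hom_cring.intro ring_hom_cring_axioms.intro ring_hom_memI)
  show "cring (mpoly_ring :: ('k, 'n) mpoly ring)"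
    by (rule cring_from_type_algebra)
  show "cring (semigroup_ring (gen_semigroup w) :: ('k, 'r) mpoly ring)"
  proof (rule cring_semigroup_ring)
    show "0 \<in> gen_semigroup w"
      using monom_degree_0[of w] by (metis gen_semigroup_eq_range rangeI)
    show "s + t \<in> gen_semigroup w" if "s \<in> gen_semigroup w" "t \<in> gen_semigroup w" for s t
      using that monom_degree_add[of w] by (auto simp: gen_semigroup_eq_range) (metis rangeI)
  qed
qed (simp_all add: keys_semigroup_hom semigroup_hom_add semigroup_hom_mult semigroup_hom_1)

text \<open>Equality, and not only the inclusion, is what lets the grading of the quotient be recognised as the
  preimage of that of the semigroup ring. A nonzero element of degree $g$ is $c\,t^g$ with $g$ in the
  semigroup, and lifts to $c$ times any monomial of degree $g$.\<close>

lemma semigroup_hom_image_poly_comp: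
  fixes w :: "(nat ^ 'r :: finite) ^ 'n :: finite"
  shows "semigroup_hom w ` poly_comp w g = (semigroup_comp w g :: ('k :: field, 'r) mpoly set)"
proof
  show "semigroup_hom w ` poly_comp w g \<subseteq> (semigroup_comp w g :: ('k, 'r) mpoly set)"
  proof
    fix q :: "('k, 'r) mpoly" assume "q \<in> semigroup_hom w ` poly_comp w g"
    then obtain p :: "('k, 'n) mpoly" where p: "p \<in> poly_comp w g" "q = semigroup_hom w p"
      by auto
    have "semigroup_hom w p =
      (\<Sum>m\<in>Poly_Mapping.keys p. Poly_Mapping.single g (Poly_Mapping.lookup p m))"
      using p(1) unfolding poly_comp_def
      by (subst semigroup_hom_sum_superset[OF finite_keys order_refl]) (auto intro!: sum.cong)
    also have "Poly_Mapping.keys \<dots> \<subseteq> {g}"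
      by (auto simp: in_keys_iff lookup_sum lookup_single when_def
          elim!: sum.not_neutral_contains_not_neutral split: if_splits)
    finally show "q \<in> semigroup_comp w g"
      using keys_semigroup_hom[of w p] p(2) by (simp add: semigroup_comp_def)
  qed
  show "(semigroup_comp w g :: ('k, 'r) mpoly set) \<subseteq> semigroup_hom w ` poly_comp w g"
  proof
    fix q :: "('k, 'r) mpoly" assume q: "q \<in> semigroup_comp w g"
    show "q \<in> semigroup_hom w ` poly_comp w g"
    proof (cases "q = 0")
      case True
      then show ?thesis
        by (intro image_eqI[of _ _ 0]) (auto simp: semigroup_hom_0 poly_comp_def)
    next
      case False
      then have "Poly_Mapping.keys q = {g}"
        using q by (auto simp: semigroup_comp_def subset_singleton_iff)
      moreover from this obtain m where m: "g = monom_degree w m"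
        using q by (auto simp: semigroup_comp_def gen_semigroup_eq_range)
      ultimately have "q = Poly_Mapping.single (monom_degree w m) (Poly_Mapping.lookup q g)"
        by (intro poly_mapping_eqI)
           (auto simp: lookup_single when_def simp flip: not_in_keys_iff_lookup_eq_zero)
      then show ?thesis
        by (intro image_eqI[of _ _ "Poly_Mapping.single m (Poly_Mapping.lookup q g)"])
           (auto simp: semigroup_hom_single poly_comp_def m)
    qed
  qed
qed

lemma semigroup_hom_surj:
  fixes w :: "(nat ^ 'r :: finite) ^ 'n :: finite"
  shows "range (semigroup_hom w) =
    carrier (semigroup_ring (gen_semigroup w) :: ('k :: field, 'r) mpoly ring)"
proof
  show "range (semigroup_hom w) \<subseteq> carrier (semigroup_ring (gen_semigroup w) :: ('k, 'r) mpoly ring)"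
    using keys_semigroup_hom[of w] by auto
  show "carrier (semigroup_ring (gen_semigroup w) :: ('k, 'r) mpoly ring) \<subseteq> range (semigroup_hom w)"
  proof
    fix q :: "('k, 'r) mpoly"
    assume "q \<in> carrier (semigroup_ring (gen_semigroup w))"
    then have keys: "Poly_Mapping.keys q \<subseteq> range (monom_degree w)"
      by (simp add: gen_semigroup_eq_range)
    \<comment> \<open>A monomial of each degree that occurs.\<close>
    define e where "e = inv_into UNIV (monom_degree w)"
    have e: "monom_degree w (e s) = s" if "s \<in> Poly_Mapping.keys q" for s
      using keys that by (auto simp: e_def f_inv_into_f)
    have "semigroup_hom w (\<Sum>s\<in>Poly_Mapping.keys q. Poly_Mapping.single (e s) (Poly_Mapping.lookup q s))
      = (\<Sum>s\<in>Poly_Mapping.keys q. Poly_Mapping.single s (Poly_Mapping.lookup q s))"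
      unfolding semigroup_hom_sum semigroup_hom_single by (intro sum.cong refl) (simp add: e)
    also have "\<dots> = q"
      by (rule poly_mapping_sum_single[symmetric])
    finally show "q \<in> range (semigroup_hom w)"
      by (metis rangeI)
  qed
qed

lemma defining_ideal_eq: "defining_ideal w = {p. semigroup_hom w p = 0}"
  for w :: "(nat ^ 'r :: finite) ^ 'n :: finite"
  by (simp add: defining_ideal_def a_kernel_def')

section \<open>Gradings of the semigroup ring and of the quotient\<close>

text \<open>Both the quotient and the semigroup ring are modules over the polynomial ring in this way, along the
  projection and along the homomorphism to the semigroup ring; the module axioms are then proved
  once.\<close>

definition restrict_scalars :: "('a \<Rightarrow> 'b) \<Rightarrow> ('b, 'm) ring_scheme \<Rightarrow> ('a, 'b) module" where
  "restrict_scalars h Q =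
     \<lparr>carrier = carrier Q, monoid.mult = monoid.mult Q, one = one Q,
      ring.zero = ring.zero Q, add = add Q, module.smult = (\<lambda>r x. monoid.mult Q (h r) x)\<rparr>"

lemma restrict_scalars_simps [simp]:
  "carrier (restrict_scalars h Q) = carrier Q" "ring.zero (restrict_scalars h Q) = ring.zero Q"
  "add (restrict_scalars h Q) = add Q"
  "module.smult (restrict_scalars h Q) r x = monoid.mult Q (h r) x"
  by (simp_all add: restrict_scalars_def)

lemma finsum_restrict_scalars: "finsum (restrict_scalars h Q) = finsum Q"
  by (simp add: finsum_def finprod_def fun_eq_iff)

lemma module_restrict_scalars:
  assumes "ring_hom_cring R Q h"
  shows "Module.module R (restrict_scalars h Q)"
proof -
  interpret ring_hom_cring R Q h by fact
  show ?thesis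
  proof (rule moduleI)
    show "abelian_group (restrict_scalars h Q)"
    proof (rule abelian_groupI)
      fix x assume "x \<in> carrier (restrict_scalars h Q)"
      then show "\<exists>y\<in>carrier (restrict_scalars h Q).
        y \<oplus>\<^bsub>restrict_scalars h Q\<^esub> x = \<zero>\<^bsub>restrict_scalars h Q\<^esub>"
        by (intro bexI[of _ "\<ominus>\<^bsub>Q\<^esub> x"]) (auto simp: S.l_neg)
    qed (auto simp: S.a_ac)
  qed (auto simp: S.l_distr S.r_distr S.m_assoc R.is_cring)
qed

lemma quotient_module_eq: "quotient_module I = restrict_scalars (a_r_coset mpoly_ring I) (mpoly_ring Quot I)"
  by (simp add: quotient_module_def restrict_scalars_def Let_def)

lemma semigroup_module_eq:
  "semigroup_module w = restrict_scalars (semigroup_hom w) (semigroup_ring (gen_semigroup w))"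
  by (simp add: semigroup_module_def restrict_scalars_def Let_def)

lemma finsum_semigroup_ring:
  fixes S :: "(nat ^ 'r :: finite) set" and c :: "'a \<Rightarrow> ('k :: field, 'r) mpoly"
  assumes "abelian_group (semigroup_ring S :: ('k, 'r) mpoly ring)"
    and "finite G" "\<And>g. g \<in> G \<Longrightarrow> Poly_Mapping.keys (c g) \<subseteq> S"
  shows "finsum (semigroup_ring S) c G = (\<Sum>g\<in>G. c g)"
proof -
  interpret abelian_group "semigroup_ring S :: ('k, 'r) mpoly ring" by fact
  show ?thesis
    using assms(2,3)
  proof (induction G rule: finite_induct)
    case empty
    show ?case by simp
  next
    case (insert g G)
    have "c \<in> G \<rightarrow> carrier (semigroup_ring S)" "c g \<in> carrier (semigroup_ring S)"
      using insert.prems by auto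
    then show ?case
      using insert by (simp add: finsum_insert)
  qed
qed

text \<open>The component of degree $g$ consists of the multiples of $t^g$, so the decomposition of $x$ has to be
  the one into its terms.\<close>

lemma graded_semigroup_module:
  fixes w :: "(nat ^ 'r :: finite) ^ 'n :: finite"
  shows "graded_module mpoly_ring (poly_comp w)
    (semigroup_module w :: (('k :: field, 'n) mpoly, ('k, 'r) mpoly) module) (semigroup_comp w)"
proof -
  let ?S = "gen_semigroup w"
  let ?K = "semigroup_ring ?S :: ('k, 'r) mpoly ring"
  let ?M = "semigroup_module w :: (('k, 'n) mpoly, ('k, 'r) mpoly) module"
  interpret hom: ring_hom_cring mpoly_ring ?K "semigroup_hom w"
    by (rule ring_hom_semigroup_hom)
  interpret M: Module.module mpoly_ring ?M
    unfolding semigroup_module_eq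
    by (rule module_restrict_scalars) (rule ring_hom_semigroup_hom)
  have simps: "carrier ?M = {p. Poly_Mapping.keys p \<subseteq> ?S}" "add ?M = (+)" "ring.zero ?M = 0"
    "module.smult ?M = (\<lambda>r x. semigroup_hom w r * x)"
    by (simp_all add: semigroup_module_eq fun_eq_iff)
  have minus: "a_inv ?M p = - p" if "p \<in> carrier ?M" for p
    using that by (intro M.M.minus_equality) (auto simp: simps in_keys_iff)
  show ?thesis
    unfolding graded_module_def
  proof (intro conjI allI ballI)
    show "Module.module mpoly_ring ?M" by (rule M.module_axioms)
    show "additive_subgroup (semigroup_comp w g) ?M" for g
    proof (intro additive_subgroup.intro M.add.subgroupI)
      show "semigroup_comp w g \<subseteq> carrier ?M"
        by (auto simp: semigroup_comp_def simps)
      have "0 \<in> semigroup_comp w g" by (simp add: semigroup_comp_def)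
      then show "semigroup_comp w g \<noteq> {}" by blast
      show "\<ominus>\<^bsub>?M\<^esub> p \<in> semigroup_comp w g" if "p \<in> semigroup_comp w g" for p
      proof -
        have "p \<in> carrier ?M" using that by (simp add: semigroup_comp_def simps)
        from minus[OF this] show ?thesis
          using that by (auto simp: semigroup_comp_def in_keys_iff subset_iff)
      qed
      show "p \<oplus>\<^bsub>?M\<^esub> q \<in> semigroup_comp w g"
        if "p \<in> semigroup_comp w g" "q \<in> semigroup_comp w g" for p q
        using that Poly_Mapping.keys_add[of p q] by (auto simp: semigroup_comp_def simps)
    qed
    show "r \<odot>\<^bsub>?M\<^esub> x \<in> semigroup_comp w (g + h)"
      if r: "r \<in> poly_comp w g" and x: "x \<in> semigroup_comp w h" for g h r x
    proof -
      have r': "semigroup_hom w r \<in> (semigroup_comp w g :: ('k, 'r) mpoly set)"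
        using r semigroup_hom_image_poly_comp by blast
      have "r \<odot>\<^bsub>?M\<^esub> x \<in> carrier ?M"
        using x by (intro M.smult_closed) (auto simp: semigroup_comp_def simps)
      moreover have "Poly_Mapping.keys (semigroup_hom w r * x) \<subseteq> {g + h}"
        using r' x keys_mult[of "semigroup_hom w r" x] by (auto simp: semigroup_comp_def) blast
      ultimately show ?thesis by (simp add: semigroup_comp_def simps)
    qed
    fix x assume x: "x \<in> carrier ?M"
    have finsum: "finsum ?M c G = (\<Sum>g\<in>G. c g)"
      if "finite G" "\<And>g. c g \<in> semigroup_comp w g" for c G
      unfolding semigroup_module_eq finsum_restrict_scalars
      by (rule finsum_semigroup_ring[OF hom.S.abelian_group_axioms that(1)])
         (use that(2) in \<open>auto simp: semigroup_comp_def\<close>)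
    have decomp_iff: "(\<forall>g. c g \<in> semigroup_comp w g) \<and> finite {g. c g \<noteq> \<zero>\<^bsub>?M\<^esub>} \<and>
        x = finsum ?M c {g. c g \<noteq> \<zero>\<^bsub>?M\<^esub>} \<longleftrightarrow>
        c = (\<lambda>g. Poly_Mapping.single g (Poly_Mapping.lookup x g))" for c
    proof
      assume *: "c = (\<lambda>g. Poly_Mapping.single g (Poly_Mapping.lookup x g))"
      have supp: "{g. c g \<noteq> \<zero>\<^bsub>?M\<^esub>} = Poly_Mapping.keys x"
        by (auto simp: * simps in_keys_iff) (metis single_zero inj_single lookup_single_eq lookup_zero)+
      have comp: "c g \<in> semigroup_comp w g" for g
        using x by (auto simp: * simps semigroup_comp_def in_keys_iff)
      show "(\<forall>g. c g \<in> semigroup_comp w g) \<and> finite {g. c g \<noteq> \<zero>\<^bsub>?M\<^esub>} \<and>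
        x = finsum ?M c {g. c g \<noteq> \<zero>\<^bsub>?M\<^esub>}"
        unfolding supp using comp by (simp add: finsum) (simp add: * flip: poly_mapping_sum_single)
    next
      assume *: "(\<forall>g. c g \<in> semigroup_comp w g) \<and> finite {g. c g \<noteq> \<zero>\<^bsub>?M\<^esub>} \<and>
        x = finsum ?M c {g. c g \<noteq> \<zero>\<^bsub>?M\<^esub>}"
      let ?G = "{g. c g \<noteq> 0}"
      have fin: "finite ?G" and keys: "\<And>g. Poly_Mapping.keys (c g) \<subseteq> {g}"
        using * by (auto simp: simps semigroup_comp_def)
      have x_eq: "x = (\<Sum>g\<in>?G. c g)"
        using * by (simp add: finsum simps)
      have single: "c g = Poly_Mapping.single g (Poly_Mapping.lookup (c g) g)" for g
        using keys[of g]
        by (intro poly_mapping_eqI) (auto simp: lookup_single when_def in_keys_iff)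
      have "Poly_Mapping.lookup x g = Poly_Mapping.lookup (c g) g" for g
      proof -
        have "Poly_Mapping.lookup x g = (\<Sum>h\<in>?G. if h = g then Poly_Mapping.lookup (c g) g else 0)"
          unfolding x_eq lookup_sum
          by (intro sum.cong refl) (use keys in \<open>auto simp: subset_iff in_keys_iff\<close>)
        also have "\<dots> = Poly_Mapping.lookup (c g) g"
          using fin by simp
        finally show ?thesis .
      qed
      then show "c = (\<lambda>g. Poly_Mapping.single g (Poly_Mapping.lookup x g))"
        using single by (metis ext)
    qed
    show "\<exists>!c. (\<forall>g. c g \<in> semigroup_comp w g) \<and> finite {g. c g \<noteq> \<zero>\<^bsub>?M\<^esub>} \<and>
        x = finsum ?M c {g. c g \<noteq> \<zero>\<^bsub>?M\<^esub>}"
      unfolding decomp_iff by blast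
  qed
qed

text \<open>Components of a grading that is carried over along a homomorphism are preimages; this supplies their
  closure properties.\<close>

lemma additive_subgroup_preimage:
  fixes M :: "('a, 'b) module" and N :: "('a, 'c) module"
  assumes "abelian_group M" "abelian_group N" and C: "additive_subgroup C N"
    and closed: "f \<in> carrier M \<rightarrow> carrier N"
    and add: "\<And>x y. x \<in> carrier M \<Longrightarrow> y \<in> carrier M \<Longrightarrow> f (x \<oplus>\<^bsub>M\<^esub> y) = f x \<oplus>\<^bsub>N\<^esub> f y"
  shows "additive_subgroup {x \<in> carrier M. f x \<in> C} M"
proof -
  interpret M: abelian_group M by fact
  interpret N: abelian_group N by fact
  interpret C: additive_subgroup C N by fact
  interpret f: abelian_group_hom M N f
    using closed add
    by (intro abelian_group_homI M.abelian_group_axioms N.abelian_group_axioms)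
       (auto simp: group_hom_def group_hom_axioms_def hom_def M.a_group N.a_group)
  show ?thesis
    by (intro additive_subgroup.intro M.add.subgroupI)
       (auto intro: C.zero_closed C.a_closed C.a_inv_closed M.zero_closed simp flip: a_inv_def)
qed

text \<open>A bijective linear map that identifies the components turns decompositions of $x$ into decompositions
  of $f(x)$ and back, so existence and uniqueness carry over. Applied to the quotient by the defining ideal,
  this contains the fact that the ideal is homogeneous.\<close>

lemma graded_module_transport:
  fixes M :: "('a, 'b) module" and N :: "('a, 'c) module"
    and A :: "'g :: comm_monoid_add \<Rightarrow> 'a set"
  assumes N: "graded_module R A N C" and M: "Module.module R M"
    and closed: "f \<in> carrier M \<rightarrow> carrier N"
    and add: "\<And>x y. x \<in> carrier M \<Longrightarrow> y \<in> carrier M \<Longrightarrow> f (x \<oplus>\<^bsub>M\<^esub> y) = f x \<oplus>\<^bsub>N\<^esub> f y"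
    and smult: "\<And>r x. r \<in> carrier R \<Longrightarrow> x \<in> carrier M \<Longrightarrow> f (r \<odot>\<^bsub>M\<^esub> x) = r \<odot>\<^bsub>N\<^esub> f x"
    and bij: "bij_betw f (carrier M) (carrier N)"
    and A: "\<And>g. A g \<subseteq> carrier R"
    and B: "\<And>g. B g = {x \<in> carrier M. f x \<in> C g}"
  shows "graded_module R A M B"
proof -
  interpret M: Module.module R M by fact
  interpret N: Module.module R N using N by (simp add: graded_module_def)
  have f_zero: "f \<zero>\<^bsub>M\<^esub> = \<zero>\<^bsub>N\<^esub>"
  proof -
    have "f \<zero>\<^bsub>M\<^esub> \<oplus>\<^bsub>N\<^esub> f \<zero>\<^bsub>M\<^esub> = f \<zero>\<^bsub>M\<^esub>"
      using add[of "\<zero>\<^bsub>M\<^esub>" "\<zero>\<^bsub>M\<^esub>"] by simp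
    then show ?thesis
      using closed by (metis M.M.zero_closed N.M.add.r_cancel_one' PiE)
  qed
  have f_eq_iff: "f x = f y \<longleftrightarrow> x = y" if "x \<in> carrier M" "y \<in> carrier M" for x y
    using bij that by (auto simp: bij_betw_def inj_on_def)
  have f_zero_iff: "f x = \<zero>\<^bsub>N\<^esub> \<longleftrightarrow> x = \<zero>\<^bsub>M\<^esub>" if "x \<in> carrier M" for x
    using f_eq_iff[OF that, of "\<zero>\<^bsub>M\<^esub>"] f_zero by auto
  have f_finsum: "f (finsum M c G) = finsum N (\<lambda>g. f (c g)) G"
    if "finite G" "c \<in> G \<rightarrow> carrier M" for c :: "'g \<Rightarrow> 'b" and G
    using that
  proof (induction G rule: finite_induct)
    case empty
    show ?case by (simp add: f_zero)
  next
    case (insert g G)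
    then show ?case
      using closed by (simp add: add Pi_iff)
  qed
  have C_sub: "C g \<subseteq> carrier N" for g
    using N by (auto simp: graded_module_def dest: additive_subgroup.a_subset)
  show ?thesis
    unfolding graded_module_def
  proof (intro conjI allI ballI)
    show "Module.module R M" by fact
    show "additive_subgroup (B g) M" for g
      unfolding B using N
        additive_subgroup_preimage[OF M.M.abelian_group_axioms N.M.abelian_group_axioms
          _ closed add, of "C g"]
      by (simp add: graded_module_def)
    show "r \<odot>\<^bsub>M\<^esub> x \<in> B (g + h)" if "r \<in> A g" "x \<in> B h" for g h r x
    proof -
      from that A have "r \<in> carrier R" "x \<in> carrier M" "f x \<in> C h"
        by (auto simp: B)
      then show ?thesis
        using N that by (auto simp: B smult graded_module_def)
    qed
    fix x assume x: "x \<in> carrier M"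
    define D where "D c \<longleftrightarrow> (\<forall>g. c g \<in> C g) \<and> finite {g. c g \<noteq> \<zero>\<^bsub>N\<^esub>} \<and>
      f x = finsum N c {g. c g \<noteq> \<zero>\<^bsub>N\<^esub>}" for c
    define E where "E c \<longleftrightarrow> (\<forall>g. c g \<in> B g) \<and> finite {g. c g \<noteq> \<zero>\<^bsub>M\<^esub>} \<and>
      x = finsum M c {g. c g \<noteq> \<zero>\<^bsub>M\<^esub>}" for c
    have "f x \<in> carrier N" using x closed by blast
    then have D: "\<exists>!c. D c"
      using N unfolding graded_module_def D_def by (elim conjE) (rule bspec)
    have E_iff: "E c \<longleftrightarrow> D (\<lambda>g. f (c g))" if c: "\<And>g. c g \<in> carrier M" for c
    proof -
      have finsum_iff: "x = finsum M c G \<longleftrightarrow> f x = finsum N (\<lambda>g. f (c g)) G" if "finite G" for G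
      proof -
        have car: "c \<in> G \<rightarrow> carrier M" using c by blast
        show ?thesis
          unfolding f_finsum[OF that car, symmetric]
          by (rule f_eq_iff[OF x M.M.finsum_closed[OF car], symmetric])
      qed
      have support: "{g. f (c g) \<noteq> \<zero>\<^bsub>N\<^esub>} = {g. c g \<noteq> \<zero>\<^bsub>M\<^esub>}"
        by (simp only: f_zero_iff[OF c])
      have comp: "f (c g) \<in> C g \<longleftrightarrow> c g \<in> B g" for g
        using c by (simp add: B)
      show ?thesis
        unfolding D_def E_def support comp using finsum_iff by blast
    qed
    have "\<exists>!c. E c"
    proof (rule ex_ex1I)
      from D obtain c where c: "D c" by blast
      define c' where "c' g = inv_into (carrier M) f (c g)" for g
      have c': "c' g \<in> carrier M \<and> f (c' g) = c g" for g
      proof -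
        have "c g \<in> f ` carrier M"
          using bij c C_sub[of g] by (auto simp: D_def bij_betw_def)
        then show ?thesis
          by (simp add: c'_def inv_into_into f_inv_into_f)
      qed
      then have "D (\<lambda>g. f (c' g))"
        using c by simp
      then show "\<exists>c. E c"
        using c' E_iff[of c'] by blast
    next
      fix c c' assume c: "E c" and c': "E c'"
      then have car: "c g \<in> carrier M" "c' g \<in> carrier M" for g
        by (auto simp: E_def B)
      have "D (\<lambda>g. f (c g))" "D (\<lambda>g. f (c' g))"
        using c c' E_iff[of c] E_iff[of c'] car by blast+
      with D have eq: "(\<lambda>g. f (c g)) = (\<lambda>g. f (c' g))" by blast
      show "c = c'"
      proof
        fix g
        show "c g = c' g"
          using fun_cong[OF eq, of g] f_eq_iff[OF car] by simp
      qed
    qed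
    then show "\<exists>!c. (\<forall>g. c g \<in> B g) \<and> finite {g. c g \<noteq> \<zero>\<^bsub>M\<^esub>} \<and>
        x = finsum M c {g. c g \<noteq> \<zero>\<^bsub>M\<^esub>}"
      unfolding E_def .
  qed
qed

text \<open>The first isomorphism theorem gives the bijection, induced by the homomorphism to the semigroup
  ring. Its effect on components follows from \<open>semigroup_hom_image_poly_comp\<close>.\<close>

lemma quotient_graded_isomorphic:
  fixes w :: "(nat ^ 'r :: finite) ^ 'n :: finite"
  defines "I \<equiv> (defining_ideal w :: ('k :: field, 'n) mpoly set)"
  shows "graded_isomorphic mpoly_ring (poly_comp w) (quotient_module I) (quotient_comp w I)
    (semigroup_module w :: (('k, 'n) mpoly, ('k, 'r) mpoly) module) (semigroup_comp w)"
proof -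
  let ?R = "mpoly_ring :: ('k, 'n) mpoly ring"
  let ?K = "semigroup_ring (gen_semigroup w) :: ('k, 'r) mpoly ring"
  let ?h = "semigroup_hom w :: ('k, 'n) mpoly \<Rightarrow> ('k, 'r) mpoly"
  let ?Q = "quotient_module I"
  let ?M = "semigroup_module w :: (('k, 'n) mpoly, ('k, 'r) mpoly) module"
  define f where "f = (\<lambda>C. the_elem (?h ` C))"
  interpret hom: ring_hom_cring ?R ?K ?h
    by (rule ring_hom_semigroup_hom)
  have I_eq: "I = a_kernel ?R ?K ?h"
    by (simp add: I_def defining_ideal_def)
  interpret I: ideal I ?R
    unfolding I_eq by (rule hom.ring.kernel_is_ideal)
  interpret coset: ring_hom_cring ?R "?R Quot I" "a_r_coset ?R I"
    by (rule I.rcos_ring_hom_cring) (rule hom.R.is_cring)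
  have f_coset: "f (a_r_coset ?R I p) = ?h p" for p
    unfolding f_def I_eq by (rule hom.ring.the_elem_simp) simp
  have f_hom: "f \<in> ring_hom (?R Quot I) ?K"
    unfolding f_def I_eq by (rule hom.ring.the_elem_hom)
  have Q_carrier: "carrier ?Q = range (a_r_coset ?R I)"
    by (auto simp: quotient_module_eq FactRing_def A_RCOSETS_def')
  have image: "f ` carrier ?Q = carrier ?M"
    unfolding Q_carrier image_image f_coset semigroup_hom_surj
    by (simp add: semigroup_module_eq)
  have inj: "inj_on f (carrier ?Q)"
    using hom.ring.the_elem_inj unfolding inj_on_def f_def I_eq by (simp add: quotient_module_eq)
  have bij: "bij_betw f (carrier ?Q) (carrier ?M)"
    using inj image by (simp add: bij_betw_def)
  have closed: "f \<in> carrier ?Q \<rightarrow> carrier ?M"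
    using image by blast
  have add: "f (x \<oplus>\<^bsub>?Q\<^esub> y) = f x \<oplus>\<^bsub>?M\<^esub> f y" if "x \<in> carrier ?Q" "y \<in> carrier ?Q" for x y
    using ring_hom_add[OF f_hom, of x y] that by (simp add: quotient_module_eq semigroup_module_eq)
  have smult: "f (r \<odot>\<^bsub>?Q\<^esub> x) = r \<odot>\<^bsub>?M\<^esub> f x" if "x \<in> carrier ?Q" for r x
    using ring_hom_mult[OF f_hom, of "a_r_coset ?R I r" x] that coset.hom_closed[of r]
    by (simp add: quotient_module_eq semigroup_module_eq f_coset)
  have comp: "quotient_comp w I g = {x \<in> carrier ?Q. f x \<in> semigroup_comp w g}" for g
  proof -
    have "f ` quotient_comp w I g = semigroup_comp w g"
      by (simp add: quotient_comp_def image_image f_coset semigroup_hom_image_poly_comp)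
    moreover have "quotient_comp w I g \<subseteq> carrier ?Q"
      by (auto simp: Q_carrier quotient_comp_def)
    ultimately show ?thesis
      using inj by (auto simp: inj_on_def)
  qed
  have "graded_module ?R (poly_comp w) ?Q (quotient_comp w I)"
  proof (rule graded_module_transport[OF graded_semigroup_module _ closed add smult bij _ comp])
    show "Module.module ?R ?Q"
      unfolding quotient_module_eq by (rule module_restrict_scalars) (rule coset.ring_hom_cring_axioms)
  qed auto
  moreover have "f \<in> graded_hom ?R ?Q (quotient_comp w I) ?M (semigroup_comp w)"
    unfolding graded_hom_def using closed add smult by (auto simp: comp)
  ultimately show ?thesis
    unfolding graded_isomorphic_def using graded_semigroup_module bij by blast
qed

lemma augmentation_graded_hom:
  fixes w :: "(nat ^ 'r :: finite) ^ 'n :: finite"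
  defines "I \<equiv> (defining_ideal w :: ('k :: field, 'n) mpoly set)"
  shows "(\<lambda>v :: ('k, 'n) mpoly ^ 1. a_r_coset mpoly_ring I (v $ 1)) \<in>
    graded_hom mpoly_ring free_module (free_comp w (\<lambda>_. 0)) (quotient_module I) (quotient_comp w I)"
    (is "?e \<in> _")
  and "range (\<lambda>v :: ('k, 'n) mpoly ^ 1. a_r_coset mpoly_ring I (v $ 1)) = carrier (quotient_module I)"
  and "a_r_coset mpoly_ring I p = ring.zero (quotient_module I) \<longleftrightarrow> p \<in> I"
proof -
  let ?R = "mpoly_ring :: ('k, 'n) mpoly ring"
  interpret hom: ring_hom_cring ?R "semigroup_ring (gen_semigroup w)" "semigroup_hom w"
    by (rule ring_hom_semigroup_hom)
  interpret I: ideal I ?R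
    unfolding I_def defining_ideal_def by (rule hom.ring.kernel_is_ideal)
  interpret coset: ring_hom_cring ?R "?R Quot I" "a_r_coset ?R I"
    by (rule I.rcos_ring_hom_cring) (rule hom.R.is_cring)
  show "?e \<in> graded_hom mpoly_ring free_module (free_comp w (\<lambda>_. 0)) (quotient_module I) (quotient_comp w I)"
    using coset.hom_add coset.hom_mult coset.hom_closed
    by (auto simp: graded_hom_def free_module_def quotient_module_eq free_comp_def
        quotient_comp_def poly_comp_def)
  have "range ?e = range (a_r_coset ?R I)"
  proof
    show "range (a_r_coset ?R I) \<subseteq> range ?e"
    proof
      fix C assume "C \<in> range (a_r_coset ?R I)"
      then obtain p where "C = ?e (\<chi> _. p)" by auto
      then show "C \<in> range ?e" by blast
    qed
  qed auto
  then show "range ?e = carrier (quotient_module I)"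
    by (auto simp: quotient_module_eq FactRing_def A_RCOSETS_def')
  show "a_r_coset ?R I p = ring.zero (quotient_module I) \<longleftrightarrow> p \<in> I"
    using I.a_rcos_self I.a_rcos_const by (auto simp: quotient_module_eq FactRing_def)
qed

section \<open>Homogeneous matrices and minimality\<close>

text \<open>A matrix has degree 0 as soon as each entry is homogeneous of degree (column shift) $-$ (row shift),
  written additively because subtraction of exponent vectors truncates.\<close>

lemma matrix_graded_hom:
  fixes A :: "('k :: field, 'n :: finite) mpoly ^ 'q :: finite ^ 'p :: finite"
    and w :: "(nat ^ 'r :: finite) ^ 'n"
  assumes deg: "\<And>i j m. m \<in> Poly_Mapping.keys (A $ i $ j) \<Longrightarrow> monom_degree w m + s i = t j"
  shows "(*v) A \<in> graded_hom mpoly_ring free_module (free_comp w t) free_module (free_comp w s)"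
proof -
  have "A *v x \<in> free_comp w s g" if x: "x \<in> free_comp w t g" for x g
    unfolding free_comp_def mem_Collect_eq
  proof (intro allI ballI)
    fix i m assume "m \<in> Poly_Mapping.keys ((A *v x) $ i)"
    then have "(\<Sum>j\<in>UNIV. Poly_Mapping.lookup (A $ i $ j * x $ j) m) \<noteq> 0"
      by (simp add: matrix_vector_mult_def in_keys_iff lookup_sum)
    then obtain j where "m \<in> Poly_Mapping.keys (A $ i $ j * x $ j)"
      by (auto simp: in_keys_iff elim: sum.not_neutral_contains_not_neutral)
    then obtain a b where ab: "m = a + b" "a \<in> Poly_Mapping.keys (A $ i $ j)"
      "b \<in> Poly_Mapping.keys (x $ j)"
      using keys_mult by blast
    have "monom_degree w m + s i = monom_degree w b + (monom_degree w a + s i)"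
      by (simp add: ab(1) monom_degree_add ac_simps)
    also have "\<dots> = g"
      using deg[OF ab(2)] x ab(3) by (simp add: free_comp_def)
    finally show "monom_degree w m + s i = g" .
  qed
  then show ?thesis
    by (auto simp: graded_hom_def free_module_def matrix_vector_mult_def vec_eq_iff
        distrib_left sum.distrib sum_distrib_left mult_ac)
qed

lemma range_matrix_irrelevant:
  fixes A :: "('k :: field, 'n :: finite) mpoly ^ 'q :: finite ^ 'p :: finite"
  assumes "\<And>i j. A $ i $ j \<in> irrelevant_ideal"
  shows "range ((*v) A) \<subseteq> {v. \<forall>i. v $ i \<in> irrelevant_ideal}"
proof -
  interpret R: cring "mpoly_ring :: ('k, 'n) mpoly ring"
    by (rule cring_from_type_algebra)
  interpret ideal irrelevant_ideal "mpoly_ring :: ('k, 'n) mpoly ring"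
    unfolding irrelevant_ideal_def by (rule R.genideal_ideal) simp
  have "(\<Sum>j\<in>J. A $ i $ j * x $ j) \<in> irrelevant_ideal" for i x J
  proof (induction J rule: infinite_finite_induct)
    case (insert j J)
    then show ?case
      using a_closed I_r_closed[OF assms] by simp
  qed (use zero_closed in simp_all)
  then show ?thesis
    by (auto simp: matrix_vector_mult_def)
qed

lemma irrelevant_ideal_closed:
  fixes p q :: "('k :: field, 'n :: finite) mpoly"
  shows "Var i \<in> (irrelevant_ideal :: ('k, 'n) mpoly set)" "p \<in> irrelevant_ideal \<Longrightarrow> - p \<in> irrelevant_ideal"
    "p \<in> irrelevant_ideal \<Longrightarrow> p * q \<in> irrelevant_ideal"
    "p \<in> irrelevant_ideal \<Longrightarrow> q \<in> irrelevant_ideal \<Longrightarrow> p - q \<in> irrelevant_ideal"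
proof -
  interpret R: cring "mpoly_ring :: ('k, 'n) mpoly ring"
    by (rule cring_from_type_algebra)
  interpret ideal irrelevant_ideal "mpoly_ring :: ('k, 'n) mpoly ring"
    unfolding irrelevant_ideal_def by (rule R.genideal_ideal) simp
  show "Var i \<in> (irrelevant_ideal :: ('k, 'n) mpoly set)"
    unfolding irrelevant_ideal_def
    using R.genideal_self[of "range Var"] by auto
  show mult: "p * q \<in> irrelevant_ideal" if "p \<in> irrelevant_ideal" for p q :: "('k, 'n) mpoly"
    using I_r_closed[OF that] by simp
  show minus: "- p \<in> irrelevant_ideal" if "p \<in> irrelevant_ideal" for p :: "('k, 'n) mpoly"
    using mult[OF that, of "- 1"] by simp
  show "p - q \<in> irrelevant_ideal" if "p \<in> irrelevant_ideal" "q \<in> irrelevant_ideal"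
    using a_closed[OF that(1) minus[OF that(2)]] by simp
qed

section \<open>Normal forms modulo the minors\<close>

definition minor1 :: "('k :: field, 4) mpoly" where "minor1 = (Var 2)\<^sup>2 - Var 1 * Var 3"

definition minor2 :: "('k :: field, 4) mpoly" where "minor2 = Var 2 * Var 3 - Var 1 * Var 4"

definition minor3 :: "('k :: field, 4) mpoly" where "minor3 = (Var 3)\<^sup>2 - Var 2 * Var 4"

lemmas minor_defs = minor1_def minor2_def minor3_def

definition minor_span :: "('k :: field, 4) mpoly set" where
  "minor_span = {u1 * minor1 + u2 * minor2 + u3 * minor3 | u1 u2 u3. True}"

lemma minor_spanI: "u1 * minor1 + u2 * minor2 + u3 * minor3 \<in> minor_span"
  by (auto simp: minor_span_def)

lemma minor_span_add: "p \<in> minor_span \<Longrightarrow> q \<in> minor_span \<Longrightarrow> p + q \<in> minor_span"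
proof -
  assume "p \<in> minor_span" "q \<in> minor_span"
  then obtain u1 u2 u3 v1 v2 v3 where
    "p = u1 * minor1 + u2 * minor2 + u3 * minor3" "q = v1 * minor1 + v2 * minor2 + v3 * minor3"
    by (auto simp: minor_span_def)
  then have "p + q = (u1 + v1) * minor1 + (u2 + v2) * minor2 + (u3 + v3) * minor3"
    by (simp add: algebra_simps)
  then show ?thesis by (simp add: minor_spanI)
qed

text \<open>Each of the rules $x_2^2 \to x_1x_3$, $x_2x_3 \to x_1x_4$, $x_3^2 \to x_2x_4$ changes a monomial by
  a multiple of a minor and lowers the total exponent of $x_2$ and $x_3$. One of them applies as long
  as that exponent is at least 2.\<close>

lemma reduce_mod_minors:
  fixes p :: "('k :: field, 4) mpoly"
  shows "\<exists>q. p - q \<in> minor_span \<and> (\<forall>m\<in>Poly_Mapping.keys q. m $ 2 + m $ 3 \<le> 1)"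
proof (induction p rule: poly_mapping_add_induct)
  case (single m c)
  show ?case
  proof (induction "m $ 2 + m $ 3" arbitrary: m rule: less_induct)
    case less
    have step: "?case" if m: "m = axis i 1 + (axis j 1 + n)" and f: "Var i * Var j - Var k * Var l \<in> {minor1, minor2, minor3 :: ('k, 4) mpoly}"
       and d: "i \<in> {2, 3}" "j \<in> {2, 3}" "k \<notin> {2, 3} \<or> l \<notin> {2, 3}" for i j k l n
    proof -
      let ?n = "axis k 1 + (axis l 1 + n)"
      have "?n $ 2 + ?n $ 3 < m $ 2 + m $ 3"
        using d by (auto simp: m axis_def)
      from less[OF this] obtain q where q: "Poly_Mapping.single ?n c - q \<in> minor_span"
        "\<forall>m\<in>Poly_Mapping.keys q. m $ 2 + m $ 3 \<le> 1" by auto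
      have "Poly_Mapping.single n c * f \<in> minor_span" if "f \<in> {minor1, minor2, minor3}" for f
        using that minor_spanI[of "Poly_Mapping.single n c" 0 0]
          minor_spanI[of 0 "Poly_Mapping.single n c" 0] minor_spanI[of 0 0 "Poly_Mapping.single n c"]
        by auto
      note multiple = this[OF f]
      have eq: "Poly_Mapping.single n c * (Var i * Var j - Var k * Var l) =
          Poly_Mapping.single m c - Poly_Mapping.single ?n c"
        unfolding m Var_mult_single[symmetric] by (simp add: right_diff_distrib mult_ac)
      have "Poly_Mapping.single m c - q \<in> minor_span"
        using minor_span_add[OF multiple q(1)] unfolding eq by simp
      with q(2) show ?thesis by blast
    qed
    consider "m $ 2 + m $ 3 \<le> 1" | "m $ 2 \<ge> 2" | "m $ 2 \<ge> 1" "m $ 3 \<ge> 1" | "m $ 3 \<ge> 2"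
      by linarith
    then show ?case
    proof cases
      case 1
      then show ?thesis
        using minor_spanI[of 0 0 0] by (intro exI[of _ "Poly_Mapping.single m c"]) auto
    next
      case 2
      then have "m $ 2 \<noteq> 0" by simp
      then obtain n where n: "m = axis 2 1 + n" by (rule exponent_split)
      with 2 have "n $ 2 \<noteq> 0" by (auto simp: axis_def)
      then obtain n' where "n = axis 2 1 + n'" by (rule exponent_split)
      then have "m = axis 2 1 + (axis 2 1 + n')" by (simp only: n)
      moreover have "Var 2 * Var 2 - Var 1 * Var 3 = (minor1 :: ('k, 4) mpoly)"
        by (simp only: minor_defs power2_eq_square)
      ultimately show ?thesis
        by (intro step[of 2 2 n' 1 3]) simp_all
    next
      case 3
      then have "m $ 2 \<noteq> 0" by simp
      then obtain n where n: "m = axis 2 1 + n" by (rule exponent_split)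
      with 3 have "n $ 3 \<noteq> 0" by (auto simp: axis_def)
      then obtain n' where "n = axis 3 1 + n'" by (rule exponent_split)
      then have "m = axis 2 1 + (axis 3 1 + n')" by (simp only: n)
      moreover have "Var 2 * Var 3 - Var 1 * Var 4 = (minor2 :: ('k, 4) mpoly)"
        by (simp only: minor_defs power2_eq_square)
      ultimately show ?thesis
        by (intro step[of 2 3 n' 1 4]) simp_all
    next
      case 4
      then have "m $ 3 \<noteq> 0" by simp
      then obtain n where n: "m = axis 3 1 + n" by (rule exponent_split)
      with 4 have "n $ 3 \<noteq> 0" by (auto simp: axis_def)
      then obtain n' where "n = axis 3 1 + n'" by (rule exponent_split)
      then have "m = axis 3 1 + (axis 3 1 + n')" by (simp only: n)
      moreover have "Var 3 * Var 3 - Var 2 * Var 4 = (minor3 :: ('k, 4) mpoly)"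
        by (simp only: minor_defs power2_eq_square)
      ultimately show ?thesis
        by (intro step[of 3 3 n' 2 4]) simp_all
    qed
  qed
next
  case (add p p')
  then obtain q q' where "p - q \<in> minor_span" "p' - q' \<in> minor_span"
    "\<forall>m\<in>Poly_Mapping.keys q. m $ 2 + m $ 3 \<le> 1" "\<forall>m\<in>Poly_Mapping.keys q'. m $ 2 + m $ 3 \<le> 1"
    by blast
  moreover have "p + p' - (q + q') = (p - q) + (p' - q')" by simp
  moreover have "\<forall>m\<in>Poly_Mapping.keys (q + q'). m $ 2 + m $ 3 \<le> 1"
    using calculation(3,4) Poly_Mapping.keys_add[of q q'] by blast
  ultimately show ?case
    by (metis minor_span_add)
qed

section \<open>Syzygies of the minors\<close>

definition x3_free :: "('k :: field, 4) mpoly \<Rightarrow> bool" where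
  "x3_free p \<longleftrightarrow> (\<forall>m\<in>Poly_Mapping.keys p. m $ 3 = 0)"

lemma x3_free_add: "x3_free p \<Longrightarrow> x3_free q \<Longrightarrow> x3_free (p + q)"
  using Poly_Mapping.keys_add[of p q] by (auto simp: x3_free_def)

text \<open>The variable $x_3$ separates the minors: $f_3$ is monic of degree 2 in it, $f_1$ and $f_2$ have degree
  1. First the largest power of $x_3$ in $u_3f_3$ has nothing to cancel against, so $u_3 = 0$. The
  parts of $u_1f_1 + u_2f_2$ with exponents 0 and 1 of $x_3$ must then vanish separately, giving
  $x_2^2u_1 = x_1x_4u_2$ and $x_1u_1 = x_2u_2$, hence $x_2^3u_1 = x_1^2x_4u_1$.\<close>

lemma x3_free_syzygy_trivial:
  fixes u1 u2 u3 :: "('k :: field, 4) mpoly"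
  assumes free: "x3_free u1" "x3_free u2"
    and syz: "u1 * minor1 + u2 * minor2 + u3 * minor3 = 0"
  shows "u1 = 0" "u2 = 0" "u3 = 0"
proof -
  let ?x = "Var :: 4 \<Rightarrow> ('k, 4) mpoly"
  show u3: "u3 = 0"
  proof (rule ccontr)
    assume "u3 \<noteq> 0"
    then obtain k where k: "k \<in> Poly_Mapping.keys u3"
      and max: "\<And>l. l \<in> Poly_Mapping.keys u3 \<Longrightarrow> l $ 3 \<le> k $ 3"
      using ex_key_max[of u3 3] by blast
    \<comment> \<open>Solve the relation for the term $x_3^2 u_3$; in every other term the exponent of
      $x_3$ exceeds the largest one in $u_3$ by at most 1.\<close>
    let ?r = "?x 2 * (?x 4 * u3) - ?x 2 * (?x 2 * u1) + ?x 1 * (?x 3 * u1)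
      - ?x 2 * (?x 3 * u2) + ?x 1 * (?x 4 * u2)"
    let ?top = "axis 3 1 + (axis 3 1 + k)"
    have "?x 3 * (?x 3 * u3) - ?r = u1 * minor1 + u2 * minor2 + u3 * minor3"
      by (simp add: minor_defs algebra_simps power2_eq_square)
    then have eq: "?x 3 * (?x 3 * u3) = ?r"
      using syz by simp
    have "?top \<in> Poly_Mapping.keys (?x 3 * (?x 3 * u3))"
      using k by (simp add: keys_Var_mult)
    then have "?top \<in> Poly_Mapping.keys ?r"
      by (simp only: eq)
    moreover have "Poly_Mapping.keys ?r \<subseteq> {l. l $ 3 \<le> k $ 3 + 1}"
      using max free[unfolded x3_free_def]
      by (intro keys_add_subset keys_diff_subset) (auto simp: keys_Var_mult axis_def le_SucI)
    ultimately show False by (auto simp: axis_def)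
  qed
  \<comment> \<open>The relation now reads $L = x_3 q$ with $L$ free of $x_3$, so both sides are 0.\<close>
  let ?L = "?x 2 * (?x 2 * u1) - ?x 1 * (?x 4 * u2)"
  let ?q = "?x 1 * u1 - ?x 2 * u2"
  have "?L - ?x 3 * ?q = u1 * minor1 + u2 * minor2 + u3 * minor3"
    using u3 by (simp add: minor_defs algebra_simps power2_eq_square)
  then have eq: "?L = ?x 3 * ?q"
    using syz by simp
  have "Poly_Mapping.keys ?L \<subseteq> {m. m $ 3 = 0}"
    using free[unfolded x3_free_def]
    by (intro keys_diff_subset) (auto simp: keys_Var_mult axis_def)
  moreover have "Poly_Mapping.keys (?x 3 * ?q) \<subseteq> {m. m $ 3 \<noteq> 0}"
    unfolding keys_Var_mult by (auto simp: axis_def)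
  ultimately have "Poly_Mapping.keys ?L \<subseteq> {}"
    using eq by fastforce
  then have "?L = 0" by simp
  with eq have q: "?q = 0"
    by (metis Var_eq_tpow tpow_mult_eq_0_iff)
  have "?x 2 * (?x 2 * (?x 2 * u1)) = ?x 2 * (?x 1 * (?x 4 * u2))"
    using \<open>?L = 0\<close> by simp
  also have "\<dots> = ?x 1 * (?x 4 * (?x 2 * u2))"
    by (simp add: algebra_simps)
  also have "?x 2 * u2 = ?x 1 * u1" using q by simp
  finally have "tpow (axis 1 1 + (axis 4 1 + axis 1 1)) * u1 = tpow (axis 2 1 + (axis 2 1 + axis 2 1)) * u1"
    by (simp add: Var_eq_tpow tpow_mult_tpow[symmetric] mult.assoc)
  then show u1: "u1 = 0"
    by (rule tpow_mult_eq_tpow_mult_imp_zero[where i = 2]) (simp add: axis_def)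
  show "u2 = 0"
    using q u1 by (simp add: Var_eq_tpow tpow_mult_eq_0_iff)
qed

text \<open>The columns of $\delta_2$ read $x_3e_1 \equiv x_2e_2 - x_1e_3$ and $x_3e_2 \equiv x_4e_1 + x_2e_3$.
  Each use replaces a term in the first two coordinates by one with a factor $x_3$ less in the other of
  them. The two coordinates feed each other, so the induction on the exponent of $x_3$ treats them
  together.\<close>

lemma reduce_mod_delta2:
  fixes u1 u2 :: "('k :: field, 4) mpoly"
  shows "\<exists>c1 c2. x3_free (u1 + Var 3 * c1 - Var 4 * c2) \<and> x3_free (u2 - Var 2 * c1 + Var 3 * c2)"
proof -
  define Q :: "('k, 4) mpoly \<Rightarrow> ('k, 4) mpoly \<Rightarrow> bool" where
    "Q p q \<longleftrightarrow> (\<exists>c1 c2. x3_free (p + Var 3 * c1 - Var 4 * c2) \<and> x3_free (q - Var 2 * c1 + Var 3 * c2))"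
    for p q
  have Q_add: "Q (p + p') (q + q')" if "Q p q" "Q p' q'" for p q p' q'
  proof -
    from that obtain c1 c2 c1' c2' where
      "x3_free (p + Var 3 * c1 - Var 4 * c2)" "x3_free (q - Var 2 * c1 + Var 3 * c2)"
      "x3_free (p' + Var 3 * c1' - Var 4 * c2')" "x3_free (q' - Var 2 * c1' + Var 3 * c2')"
      unfolding Q_def by blast
    then have "x3_free ((p + Var 3 * c1 - Var 4 * c2) + (p' + Var 3 * c1' - Var 4 * c2'))"
      "x3_free ((q - Var 2 * c1 + Var 3 * c2) + (q' - Var 2 * c1' + Var 3 * c2'))"
      by (simp_all only: x3_free_add)
    then show ?thesis
      unfolding Q_def
      by (intro exI[of _ "c1 + c1'"] exI[of _ "c2 + c2'"]) (simp add: algebra_simps)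
  qed
  \<comment> \<open>Adding a multiple of a column of $\delta_2$ does not affect reducibility.\<close>
  have shift1: "Q p q" if "Q (p + Var 3 * b) (q - Var 2 * b)" for p q b
  proof -
    from that obtain c1 c2 where
      "x3_free (p + Var 3 * b + Var 3 * c1 - Var 4 * c2)"
      "x3_free (q - Var 2 * b - Var 2 * c1 + Var 3 * c2)"
      unfolding Q_def by blast
    then show ?thesis
      unfolding Q_def by (intro exI[of _ "b + c1"] exI[of _ c2]) (simp add: algebra_simps)
  qed
  have shift2: "Q p q" if "Q (p - Var 4 * b) (q + Var 3 * b)" for p q b
  proof -
    from that obtain c1 c2 where
      "x3_free (p - Var 4 * b + Var 3 * c1 - Var 4 * c2)"
      "x3_free (q + Var 3 * b - Var 2 * c1 + Var 3 * c2)"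
      unfolding Q_def by blast
    then show ?thesis
      unfolding Q_def by (intro exI[of _ c1] exI[of _ "b + c2"]) (simp add: algebra_simps)
  qed
  have single: "Q (Poly_Mapping.single m c) 0 \<and> Q 0 (Poly_Mapping.single m c)" for m c
  proof (induction "m $ 3" arbitrary: m)
    case 0
    then have "x3_free (Poly_Mapping.single m c)" "x3_free 0"
      by (simp_all add: x3_free_def)
    then show ?case
      unfolding Q_def by (intro conjI exI[of _ 0]) simp_all
  next
    case (Suc j)
    then have "m $ 3 \<noteq> 0" by simp
    then obtain n where n: "m = axis 3 1 + n"
      by (rule exponent_split)
    have IH: "Q (Var i * Poly_Mapping.single n c) 0 \<and> Q 0 (Var i * Poly_Mapping.single n c)"
      if "i \<noteq> 3" for i
      using Suc.hyps(1)[of "axis i 1 + n"] Suc.hyps(2) that n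
      by (simp add: Var_mult_single axis_def)
    show ?case
    proof
      show "Q (Poly_Mapping.single m c) 0"
        by (rule shift1[of _ "- Poly_Mapping.single n c"]) (use IH[of 2] in \<open>simp add: n Var_mult_single\<close>)
      show "Q 0 (Poly_Mapping.single m c)"
        by (rule shift2[of _ "- Poly_Mapping.single n c"]) (use IH[of 4] in \<open>simp add: n Var_mult_single\<close>)
    qed
  qed
  have "Q u1 0"
  proof (induction u1 rule: poly_mapping_add_induct)
    case (add p q)
    then show ?case using Q_add[of p 0 q 0] by (simp only: add_0_right)
  qed (use single in blast)
  moreover have "Q 0 u2"
  proof (induction u2 rule: poly_mapping_add_induct)
    case (add p q)
    then show ?case using Q_add[of 0 p 0 q] by (simp only: add_0_left)
  qed (use single in blast)
  ultimately have "Q u1 u2"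
    using Q_add[of u1 0 0 u2] by (simp only: add_0_left add_0_right)
  then show ?thesis
    unfolding Q_def .
qed

text \<open>Subtracting a combination of the columns of $\delta_2$ changes a syzygy into another one, so the reduced
  vector falls under \<open>x3_free_syzygy_trivial\<close> and is 0.\<close>

lemma syzygies_of_minors:
  fixes u1 u2 u3 :: "('k :: field, 4) mpoly"
  assumes syz: "u1 * minor1 + u2 * minor2 + u3 * minor3 = 0"
  obtains c1 c2 where "u1 = - Var 3 * c1 + Var 4 * c2"
    "u2 = Var 2 * c1 - Var 3 * c2" "u3 = - Var 1 * c1 + Var 2 * c2"
proof -
  obtain c1 c2 where
    "x3_free (u1 + Var 3 * c1 - Var 4 * c2)" "x3_free (u2 - Var 2 * c1 + Var 3 * c2)"
    using reduce_mod_delta2[of u1 u2] by blast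
  moreover have "(u1 + Var 3 * c1 - Var 4 * c2) * minor1 + (u2 - Var 2 * c1 + Var 3 * c2) * minor2
      + (u3 + Var 1 * c1 - Var 2 * c2) * minor3 = u1 * minor1 + u2 * minor2 + u3 * minor3"
    by (simp add: minor_defs algebra_simps power2_eq_square)
  ultimately have "u1 + Var 3 * c1 - Var 4 * c2 = 0 \<and> u2 - Var 2 * c1 + Var 3 * c2 = 0 \<and>
      u3 + Var 1 * c1 - Var 2 * c2 = 0"
    using x3_free_syzygy_trivial syz by metis
  then show ?thesis
    by (intro that[of c1 c2]) (auto simp: algebra_simps add_eq_0_iff)
qed

section \<open>The defining ideal of an arithmetic progression\<close>

lemma lin_independent_cancel:
  fixes a d :: "nat ^ 'r :: finite"
  assumes indep: "lin_independent_over_rat a d"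
    and eq: "n *s a + s *s d = n' *s a + s' *s d"
  shows "n = n'" "s = s'"
proof -
  define p q where "p = (of_nat n - of_nat n' :: rat)" and "q = (of_nat s - of_nat s' :: rat)"
  have "a \<noteq> d"
    using indep by (simp add: lin_independent_over_rat_def)
  then have neq: "rat_vec a \<noteq> rat_vec d"
    by (simp add: rat_vec_def vec_eq_iff)
  have comb: "p *s rat_vec a + q *s rat_vec d = 0"
  proof (unfold vec_eq_iff, rule allI)
    fix i
    have "n * a $ i + s * d $ i = n' * a $ i + s' * d $ i"
      using arg_cong[OF eq, of "\<lambda>v. v $ i"] by simp
    then have "of_nat n * of_nat (a $ i) + of_nat s * of_nat (d $ i) =
        (of_nat n' * of_nat (a $ i) + of_nat s' * of_nat (d $ i) :: rat)"
      unfolding of_nat_mult[symmetric] of_nat_add[symmetric] by (rule arg_cong)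
    then show "(p *s rat_vec a + q *s rat_vec d) $ i = 0 $ i"
      by (simp add: p_def q_def rat_vec_def left_diff_distrib)
  qed
  let ?u = "\<lambda>v. if v = rat_vec a then p else q"
  have "\<not> (\<exists>u. (\<exists>v\<in>{rat_vec a, rat_vec d}. u v \<noteq> 0) \<and>
      (\<Sum>v\<in>{rat_vec a, rat_vec d}. u v *s v) = 0)"
    using indep unfolding lin_independent_over_rat_def
    by (subst vec.dependent_finite[symmetric]) simp_all
  then have zero: "\<forall>v\<in>{rat_vec a, rat_vec d}. u v = 0"
    if "(\<Sum>v\<in>{rat_vec a, rat_vec d}. u v *s v) = 0" for u
    using that by blast
  have "(\<Sum>v\<in>{rat_vec a, rat_vec d}. ?u v *s v) = 0"
    using neq comb by simp
  from zero[OF this] have "p = 0" "q = 0"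
    using neq by simp_all
  then show "n = n'" "s = s'"
    by (simp_all add: p_def q_def)
qed

lemma vector_4:
  "(vector [x, y, z, t] :: ('a :: zero) ^ 4) $ 1 = x"
  "(vector [x, y, z, t] :: ('a :: zero) ^ 4) $ 2 = y"
  "(vector [x, y, z, t] :: ('a :: zero) ^ 4) $ 3 = z"
  "(vector [x, y, z, t] :: ('a :: zero) ^ 4) $ 4 = t"
  by (simp_all add: vector_def)

lemma arith_gens_nth:
  "arith_gens a d $ 1 = a" "arith_gens a d $ 2 = a + d"
  "arith_gens a d $ 3 = a + 2 *s d" "arith_gens a d $ 4 = a + 3 *s d"
  by (simp_all add: arith_gens_def vector_4)

lemma monom_degree_arith_gens:
  "monom_degree (arith_gens a d) m =
    (m $ 1 + m $ 2 + m $ 3 + m $ 4) *s a + (m $ 2 + 2 * m $ 3 + 3 * m $ 4) *s d"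
  by (simp add: monom_degree_def sum_4 arith_gens_nth vec_eq_iff algebra_simps)

text \<open>The degree determines the number $n$ of factors and the total number $s$ of steps $d$. For a normal
  monomial $m_2 + 2m_3 \in \{0, 1, 2\}$ is the residue of $s$ modulo 3, which fixes $m_2$, $m_3$ and then
  $m_4$; finally $n$ fixes $m_1$.\<close>

lemma inj_on_monom_degree_normal:
  assumes indep: "lin_independent_over_rat a d"
  shows "inj_on (monom_degree (arith_gens a d)) {m. m $ 2 + m $ 3 \<le> 1}"
proof (rule inj_onI)
  fix m n :: "nat ^ 4"
  assume normal: "m \<in> {m. m $ 2 + m $ 3 \<le> 1}" "n \<in> {m. m $ 2 + m $ 3 \<le> 1}"
    and eq: "monom_degree (arith_gens a d) m = monom_degree (arith_gens a d) n"
  have total: "m $ 1 + m $ 2 + m $ 3 + m $ 4 = n $ 1 + n $ 2 + n $ 3 + n $ 4"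
    and steps: "m $ 2 + 2 * m $ 3 + 3 * m $ 4 = n $ 2 + 2 * n $ 3 + 3 * n $ 4"
    by (rule lin_independent_cancel[OF indep eq[unfolded monom_degree_arith_gens]])+
  have digits: "x = x' \<and> y = y' \<and> z = z'"
    if "x + y \<le> 1" "x' + y' \<le> 1" "x + 2 * y + 3 * z = x' + 2 * y' + 3 * z'"
    for x y z x' y' z' :: nat
  proof -
    have "x + 2 * y = (x + 2 * y + 3 * z) mod 3" "x' + 2 * y' = (x' + 2 * y' + 3 * z') mod 3"
      using that(1,2) by simp_all
    then have "x + 2 * y = x' + 2 * y'"
      using that(3) by simp
    moreover have "y = 0 \<or> x = 0 \<and> y = 1" "y' = 0 \<or> x' = 0 \<and> y' = 1"
      using that(1,2) by linarith+
    ultimately have "x = x' \<and> y = y'"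
      using that(1,2) by auto
    then show ?thesis
      using that(3) by linarith
  qed
  have "m $ 2 = n $ 2 \<and> m $ 3 = n $ 3 \<and> m $ 4 = n $ 4"
    using normal by (intro digits steps) simp_all
  with total have "m $ 1 = n $ 1 \<and> m $ 2 = n $ 2 \<and> m $ 3 = n $ 3 \<and> m $ 4 = n $ 4"
    by linarith
  then show "m = n" by (simp add: vec_eq_iff forall_4)
qed

lemma semigroup_hom_minors:
  fixes a d :: "nat ^ 'r :: finite"
  defines "w \<equiv> arith_gens a d"
  shows "semigroup_hom w minor1 = 0" "semigroup_hom w minor2 = 0" "semigroup_hom w minor3 = 0"
proof -
  have "a + d + (a + d) = a + (a + 2 *s d)" "a + d + (a + 2 *s d) = a + (a + 3 *s d)"
    "a + 2 *s d + (a + 2 *s d) = a + d + (a + 3 *s d)"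
    by (simp_all add: vec_eq_iff)
  then show "semigroup_hom w minor1 = 0" "semigroup_hom w minor2 = 0" "semigroup_hom w minor3 = 0"
    unfolding minor_defs power2_eq_square semigroup_hom_diff semigroup_hom_mult semigroup_hom_Var
      tpow_mult_tpow w_def arith_gens_nth
    by (simp_all only: diff_self)
qed

text \<open>A polynomial and its normal form differ by an element of the span of the minors, which lies in the
  kernel. If the polynomial lies in the kernel, so does its normal form, and the homomorphism is
  injective on normal forms.\<close>

lemma defining_ideal_arith_gens:
  assumes indep: "lin_independent_over_rat a d"
  shows "defining_ideal (arith_gens a d) = (minor_span :: ('k :: field, 4) mpoly set)"
proof
  let ?h = "semigroup_hom (arith_gens a d)"
  show span: "minor_span \<subseteq> (defining_ideal (arith_gens a d) :: ('k, 4) mpoly set)"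
  proof
    fix p :: "('k, 4) mpoly" assume "p \<in> minor_span"
    then obtain u1 u2 u3 where p: "p = u1 * minor1 + u2 * minor2 + u3 * minor3"
      unfolding minor_span_def by blast
    show "p \<in> defining_ideal (arith_gens a d)"
      unfolding defining_ideal_eq mem_Collect_eq p semigroup_hom_add semigroup_hom_mult
        semigroup_hom_minors by simp
  qed
  show "defining_ideal (arith_gens a d) \<subseteq> (minor_span :: ('k, 4) mpoly set)"
  proof
    fix p :: "('k, 4) mpoly" assume p: "p \<in> defining_ideal (arith_gens a d)"
    obtain q where q: "p - q \<in> minor_span" "\<forall>m\<in>Poly_Mapping.keys q. m $ 2 + m $ 3 \<le> 1"
      using reduce_mod_minors[of p] by blast
    have "?h p - ?h q = 0"
      using subsetD[OF span q(1)] unfolding defining_ideal_eq mem_Collect_eq semigroup_hom_diff .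
    then have "?h q = 0"
      using p by (simp add: defining_ideal_eq)
    moreover have "inj_on (monom_degree (arith_gens a d)) (Poly_Mapping.keys q)"
      by (rule inj_on_subset[OF inj_on_monom_degree_normal[OF indep]]) (use q(2) in auto)
    ultimately have "q = 0"
      using semigroup_hom_eq_0_imp_eq_0 by blast
    with q(1) show "p \<in> minor_span" by simp
  qed
qed

section \<open>The resolution\<close>

lemma delta1_nth:
  "delta1 $ 1 $ 1 = minor1" "delta1 $ 1 $ 2 = minor2" "delta1 $ 1 $ 3 = minor3"
  by (simp_all add: delta1_def minor_defs)

lemma delta2_nth:
  "delta2 $ 1 $ 1 = - Var 3" "delta2 $ 1 $ 2 = Var 4"
  "delta2 $ 2 $ 1 = Var 2" "delta2 $ 2 $ 2 = - Var 3"
  "delta2 $ 3 $ 1 = - Var 1" "delta2 $ 3 $ 2 = Var 2"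
  by (simp_all add: delta2_def)

lemma delta1_mult: "(delta1 *v u) $ 1 = u $ 1 * minor1 + u $ 2 * minor2 + u $ 3 * minor3"
  by (simp add: matrix_vector_mult_def sum_3 delta1_nth mult.commute)

lemma delta2_mult:
  "(delta2 *v c) $ 1 = - Var 3 * c $ 1 + Var 4 * c $ 2"
  "(delta2 *v c) $ 2 = Var 2 * c $ 1 - Var 3 * c $ 2"
  "(delta2 *v c) $ 3 = - Var 1 * c $ 1 + Var 2 * c $ 2"
  by (simp_all add: matrix_vector_mult_def sum_2 delta2_nth)

lemma range_delta1: "range ((*v) delta1) = {v :: ('k :: field, 4) mpoly ^ 1. v $ 1 \<in> minor_span}"
proof
  show "range ((*v) delta1) \<subseteq> {v :: ('k, 4) mpoly ^ 1. v $ 1 \<in> minor_span}"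
    by (auto simp: delta1_mult intro: minor_spanI)
  show "{v :: ('k, 4) mpoly ^ 1. v $ 1 \<in> minor_span} \<subseteq> range ((*v) delta1)"
  proof
    fix v :: "('k, 4) mpoly ^ 1" assume "v \<in> {v. v $ 1 \<in> minor_span}"
    then obtain u1 u2 u3 where "v $ 1 = u1 * minor1 + u2 * minor2 + u3 * minor3"
      by (auto simp: minor_span_def)
    then have "v = delta1 *v vector [u1, u2, u3]"
      by (simp add: vec_eq_iff forall_1 delta1_mult)
    then show "v \<in> range ((*v) delta1)" by blast
  qed
qed

lemma range_delta2: "range ((*v) delta2) = {v :: ('k :: field, 4) mpoly ^ 3. delta1 *v v = 0}"
proof
  show "range ((*v) delta2) \<subseteq> {v :: ('k, 4) mpoly ^ 3. delta1 *v v = 0}"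
    by (auto simp: vec_eq_iff forall_1 delta1_mult delta2_mult)
       (simp add: minor_defs algebra_simps power2_eq_square)
  show "{v :: ('k, 4) mpoly ^ 3. delta1 *v v = 0} \<subseteq> range ((*v) delta2)"
  proof
    fix v :: "('k, 4) mpoly ^ 3" assume "v \<in> {v. delta1 *v v = 0}"
    then have "v $ 1 * minor1 + v $ 2 * minor2 + v $ 3 * minor3 = 0"
      by (simp add: vec_eq_iff forall_1 delta1_mult)
    then obtain c1 c2 where "v $ 1 = - Var 3 * c1 + Var 4 * c2"
      "v $ 2 = Var 2 * c1 - Var 3 * c2" "v $ 3 = - Var 1 * c1 + Var 2 * c2"
      by (rule syzygies_of_minors)
    then have "v = delta2 *v vector [c1, c2]"
      by (simp add: vec_eq_iff forall_3 delta2_mult)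
    then show "v \<in> range ((*v) delta2)" by blast
  qed
qed

text \<open>The last two rows suffice: for $u$, $v$ the entries of a kernel vector, $x_2u = x_3v$ and $x_2v = x_1u$ give
  $x_2^2u = x_1x_3u$.\<close>

lemma inj_delta2: "inj ((*v) (delta2 :: ('k :: field, 4) mpoly ^ 2 ^ 3))"
proof (rule injI)
  fix b c :: "('k, 4) mpoly ^ 2"
  assume eq: "delta2 *v b = delta2 *v c"
  define u v where "u = b $ 1 - c $ 1" and "v = b $ 2 - c $ 2"
  have "Var 2 * u = Var 3 * v"
    using arg_cong[OF eq, of "\<lambda>x. x $ 2"] unfolding delta2_mult by (simp add: u_def v_def algebra_simps)
  have "Var 2 * v = Var 1 * u"
    using arg_cong[OF eq, of "\<lambda>x. x $ 3"] unfolding delta2_mult by (simp add: u_def v_def algebra_simps)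
  have "Var 2 * (Var 2 * u) = Var 3 * (Var 2 * v)"
    unfolding \<open>Var 2 * u = Var 3 * v\<close> by (rule mult.left_commute)
  also have "\<dots> = Var 1 * (Var 3 * u)"
    unfolding \<open>Var 2 * v = Var 1 * u\<close> by (rule mult.left_commute)
  finally have "Var 1 * (Var 3 * u) = Var 2 * (Var 2 * u)" ..
  then have "tpow (axis 1 1 + axis 3 1) * u = tpow (axis 2 1 + axis 2 1) * u"
    by (simp add: Var_eq_tpow mult.assoc flip: tpow_mult_tpow)
  then have "u = 0"
    by (rule tpow_mult_eq_tpow_mult_imp_zero[where i = 2]) (simp add: axis_def)
  then have "v = 0"
    using \<open>Var 2 * v = Var 1 * u\<close> by (simp add: Var_eq_tpow tpow_mult_eq_0_iff)
  show "b = c"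
    using \<open>u = 0\<close> \<open>v = 0\<close> by (simp add: u_def v_def vec_eq_iff forall_2)
qed

text \<open>The degrees of the three minors, which are the shifts of the middle module.\<close>

definition minor_deg :: "nat ^ 'r \<Rightarrow> nat ^ 'r \<Rightarrow> 3 \<Rightarrow> nat ^ 'r" where
  "minor_deg a d j = vector [2 *s a + 2 *s d, 2 *s a + 3 *s d, 2 *s a + 4 *s d] $ j"

text \<open>The degrees of the two columns of $\delta_2$: for instance $x_3f_1$ has degree
  $(a + 2d) + (2a + 2d) = 3a + 4d$ and $x_4f_1$ has degree $(a + 3d) + (2a + 2d) = 3a + 5d$.\<close>

definition syzygy_deg :: "nat ^ 'r \<Rightarrow> nat ^ 'r \<Rightarrow> 2 \<Rightarrow> nat ^ 'r" where
  "syzygy_deg a d j = vector [3 *s a + 4 *s d, 3 *s a + 5 *s d] $ j"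

lemma delta1_graded_hom:
  fixes a d :: "nat ^ 'r :: finite"
  defines "w \<equiv> arith_gens a d"
  shows "(*v) (delta1 :: ('k :: field, 4) mpoly ^ 3 ^ 1) \<in> graded_hom mpoly_ring
    free_module (free_comp w (minor_deg a d)) free_module (free_comp w (\<lambda>_. 0))"
proof (rule matrix_graded_hom)
  have "Poly_Mapping.keys (minor1 :: ('k, 4) mpoly) \<subseteq> {m. monom_degree w m = minor_deg a d 1}"
    "Poly_Mapping.keys (minor2 :: ('k, 4) mpoly) \<subseteq> {m. monom_degree w m = minor_deg a d 2}"
    "Poly_Mapping.keys (minor3 :: ('k, 4) mpoly) \<subseteq> {m. monom_degree w m = minor_deg a d 3}"
    unfolding minor_defs power2_eq_square
    by (intro keys_diff_subset;
        simp add: keys_Var_mult_Var monom_degree_add monom_degree_axis w_def arith_gens_nth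
          minor_deg_def del: One_nat_def; simp add: vec_eq_iff)+
  then show "monom_degree w m + 0 = minor_deg a d j"
    if "m \<in> Poly_Mapping.keys ((delta1 :: ('k, 4) mpoly ^ 3 ^ 1) $ i $ j)" for i j m
    using that exhaust_3[of j] by (auto simp: num1_eq1[of i] delta1_nth)
qed

lemma delta2_graded_hom:
  fixes a d :: "nat ^ 'r :: finite"
  defines "w \<equiv> arith_gens a d"
  shows "(*v) (delta2 :: ('k :: field, 4) mpoly ^ 2 ^ 3) \<in> graded_hom mpoly_ring
    free_module (free_comp w (syzygy_deg a d)) free_module (free_comp w (minor_deg a d))"
proof (rule matrix_graded_hom)
  show "monom_degree w m + minor_deg a d i = syzygy_deg a d j"
    if "m \<in> Poly_Mapping.keys ((delta2 :: ('k, 4) mpoly ^ 2 ^ 3) $ i $ j)" for i j m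
    using that exhaust_3[of i] exhaust_2[of j]
    by (elim disjE)
       (simp_all add: delta2_nth keys_Var monom_degree_axis w_def arith_gens_nth
          minor_deg_def syzygy_deg_def del: One_nat_def, simp_all add: vec_eq_iff)
qed

lemma delta_irrelevant:
  "(delta1 :: ('k :: field, 4) mpoly ^ 3 ^ 1) $ i $ j \<in> irrelevant_ideal"
  "(delta2 :: ('k :: field, 4) mpoly ^ 2 ^ 3) $ k $ l \<in> irrelevant_ideal"
proof -
  have "minor1 \<in> (irrelevant_ideal :: ('k, 4) mpoly set)" "minor2 \<in> (irrelevant_ideal :: ('k, 4) mpoly set)"
    "minor3 \<in> (irrelevant_ideal :: ('k, 4) mpoly set)"
    unfolding minor_defs power2_eq_square by (intro irrelevant_ideal_closed)+
  then show "(delta1 :: ('k, 4) mpoly ^ 3 ^ 1) $ i $ j \<in> irrelevant_ideal"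
    using exhaust_3[of j] by (auto simp: num1_eq1[of i] delta1_nth)
  show "(delta2 :: ('k, 4) mpoly ^ 2 ^ 3) $ k $ l \<in> irrelevant_ideal"
    using exhaust_3[of k] exhaust_2[of l]
    by (elim disjE) (simp_all add: delta2_nth irrelevant_ideal_closed)
qed

theorem proposition5p2:
  fixes a d :: "nat ^ 2"
  assumes "lin_independent_over_rat a d"
    and "minimal_generating_set {a, a + d, a + 2 *s d, a + 3 *s d}
           (affine_semigroup {a, a + d, a + 2 *s d, a + 3 *s d})"
  shows "let w = arith_gens a d; I = (defining_ideal w :: ('k :: field, 4) mpoly set) in
         (\<exists>s2 s1. minimal_graded_free_resolution w s2 s1 (\<lambda>_. 0)
            (delta2 :: ('k, 4) mpoly ^ 2 ^ 3) (delta1 :: ('k, 4) mpoly ^ 3 ^ 1)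
            (\<lambda>v. a_r_coset mpoly_ring I (v $ 1)) (quotient_module I) (quotient_comp w I)) \<and>
         graded_isomorphic mpoly_ring (poly_comp w)
           (quotient_module I) (quotient_comp w I)
           (semigroup_module w :: (('k, 4) mpoly, ('k, 2) mpoly) module) (semigroup_comp w)"
proof -
  let ?w = "arith_gens a d"
  let ?I = "defining_ideal ?w :: ('k, 4) mpoly set"
  have iso: "graded_isomorphic mpoly_ring (poly_comp ?w) (quotient_module ?I) (quotient_comp ?w ?I)
      (semigroup_module ?w :: (('k, 4) mpoly, ('k, 2) mpoly) module) (semigroup_comp ?w)"
    by (rule quotient_graded_isomorphic)
  have "minimal_graded_free_resolution ?w (syzygy_deg a d) (minor_deg a d) (\<lambda>_. 0)
      (delta2 :: ('k, 4) mpoly ^ 2 ^ 3) (delta1 :: ('k, 4) mpoly ^ 3 ^ 1)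
      (\<lambda>v. a_r_coset mpoly_ring ?I (v $ 1)) (quotient_module ?I) (quotient_comp ?w ?I)"
    unfolding minimal_graded_free_resolution_def
  proof (intro conjI)
    show "graded_module mpoly_ring (poly_comp ?w) (quotient_module ?I) (quotient_comp ?w ?I)"
      using iso by (simp add: graded_isomorphic_def)
    show "range ((*v) (delta1 :: ('k, 4) mpoly ^ 3 ^ 1)) =
        {v. a_r_coset mpoly_ring ?I (v $ 1) = ring.zero (quotient_module ?I)}"
      unfolding augmentation_graded_hom(3)
      unfolding defining_ideal_arith_gens[OF assms(1)] by (rule range_delta1)
    show "range ((*v) (delta2 :: ('k, 4) mpoly ^ 2 ^ 3)) = {v. delta1 *v v = 0}"
      by (rule range_delta2)
  qed (rule delta1_graded_hom delta2_graded_hom augmentation_graded_hom inj_delta2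
      range_matrix_irrelevant delta_irrelevant)+
  with iso show ?thesis
    unfolding Let_def by blast
qed

end
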